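(* Let $L\subseteq\{0,1\}^*$ be a nonempty language such that the regular realizability problem $\mathrm{RR}(L)$ is decidable. Let $w_1,w_2,w_3,\ldots$ be a computable enumeration (repetitions allowed) of $L$. Let $\Sigma_\infty=\{\alpha_1,\alpha_2,\ldots\}$ be a countably infinite alphabet, let $W_\infty$ be a computable infinite word over $\Sigma_\infty$ such that every word of $\Sigma_\infty^*$ is a factor of $W_\infty$, let $\varphi\colon\Sigma_\infty^*\to\{0,1,\#\}^*$ be the morphism with $\varphi(\alpha_i)=w_i\#$ for all $i$, and let $W=\varphi(W_\infty)$, an infinite word over $\{0,1,\#\}$. Then decidability of $\mathrm{RR}(L)$ and of the prefix realizability problem $\mathrm{R}_p(W)$ are equivalent in the following sense: $$\mathrm{R}_p(W)\leqslant_{\mathrm T}\mathrm{RR}(L)\qquad\text{and}\qquad \mathrm{RR}(L)\leqslant_{\mathrm m}\mathrm{R}_p(W).$$ In particular $\mathrm{R}_p(W)$ is decidable, and the second reduction is given by $R\mapsto\tilde R=(\{0,1\}^*\#)^*R\#$: for every regular language $R\subseteq\{0,1\}^*$, $R\cap L\neq\varnothing$ if and only if $\tilde R\cap\mathrm{Pref}(W)\neq\varnothing$.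
   Context: For a language $L$ over a finite alphabet $\Sigma$, the regular realizability problem $\mathrm{RR}(L)$ is: given a regular language $R\subseteq\Sigma^*$ (described by a deterministic finite automaton), decide whether $L\cap R\neq\varnothing$. For an infinite word $W=w_1w_2\ldots$ over a finite alphabet, $\mathrm{Pref}(W)$ is the set of all its finite prefixes, and the prefix realizability problem $\mathrm{R}_p(W)$ is $\mathrm{RR}(\mathrm{Pref}(W))$. An infinite word over $\Sigma_\infty$ is computable if its $n$-th symbol (represented by its index) is a computable function of $n$. A factor is a finite word of consecutive symbols. $\varphi(W_\infty)$ is the concatenation of the images of the symbols of $W_\infty$ in order. $\leqslant_{\mathrm T}$ denotes Turing reducibility and $\leqslant_{\mathrm m}$ denotes many-one (mapping) reducibility. *)

theory Defs
  imports "HOL-Library.Stream" "HOL-Library.Nat_Bijection"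
begin

text \<open>
  Conventions: a \<open>k\<close>-letter alphabet is \<^term>\<open>{..<k::nat}\<close>, and a word over it is an element
  of \<^term>\<open>lists {..<k::nat}\<close>.  The alphabet \<open>{0, 1}\<close> is \<^term>\<open>{..<2::nat}\<close>, and \<open>{0, 1, #}\<close> is
  \<^term>\<open>{..<3::nat}\<close> with the letter \<open>#\<close> being \<open>2\<close>.  The letters of the infinite alphabet
  \<open>\<Sigma>\<^sub>\<infinity>\<close> are represented by their indices, counted from \<open>0\<close>.
\<close>

abbreviation (input) hash :: nat where
  "hash \<equiv> 2"


section \<open>Computability and reducibility\<close>

text \<open>
  The functions recursive in the set \<open>A\<close> (general recursive functions, with minimisation applied
  to regular functions only, and with the characteristic function of \<open>A\<close> added as an initial
  function).  \<open>recursive_in A n f\<close> concerns only the values of \<open>f\<close> on lists of length \<open>n\<close>;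
  the values on other lists are irrelevant.
\<close>

inductive recursive_in :: "nat set \<Rightarrow> nat \<Rightarrow> (nat list \<Rightarrow> nat) \<Rightarrow> bool" for A where
  zero: "recursive_in A n (\<lambda>xs. 0)"
| suc: "recursive_in A 1 (\<lambda>xs. Suc (hd xs))"
| proj: "i < n \<Longrightarrow> recursive_in A n (\<lambda>xs. xs ! i)"
| oracle_set: "recursive_in A 1 (\<lambda>xs. if hd xs \<in> A then 1 else 0)"
| comp: "\<lbrakk>recursive_in A (length gs) f; \<forall>g \<in> set gs. recursive_in A n g\<rbrakk>
    \<Longrightarrow> recursive_in A n (\<lambda>xs. f (map (\<lambda>g. g xs) gs))"
| prim_rec: "\<lbrakk>recursive_in A n f; recursive_in A (Suc (Suc n)) g\<rbrakk>
    \<Longrightarrow> recursive_in A (Suc n)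
          (\<lambda>xs. rec_nat (f (tl xs)) (\<lambda>k r. g (k # r # tl xs)) (hd xs))"
| minimise: "\<lbrakk>recursive_in A (Suc n) f; \<forall>xs. length xs = n \<longrightarrow> (\<exists>k. f (k # xs) = 0)\<rbrakk>
    \<Longrightarrow> recursive_in A n (\<lambda>xs. LEAST k. f (k # xs) = 0)"

definition computable_in :: "nat set \<Rightarrow> (nat \<Rightarrow> nat) \<Rightarrow> bool" where
  "computable_in A f \<longleftrightarrow> (\<exists>F. recursive_in A 1 F \<and> (\<forall>x. F [x] = f x))"

definition computable :: "(nat \<Rightarrow> nat) \<Rightarrow> bool" where
  "computable f \<longleftrightarrow> computable_in {} f"

definition turing_reducible :: "nat set \<Rightarrow> nat set \<Rightarrow> bool" (infix \<open>\<le>\<^sub>T\<close> 50) where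
  "B \<le>\<^sub>T A \<longleftrightarrow> computable_in A (\<lambda>x. if x \<in> B then 1 else 0)"

definition decidable :: "nat set \<Rightarrow> bool" where
  "decidable B \<longleftrightarrow> computable (\<lambda>x. if x \<in> B then 1 else 0)"

definition many_one_reduction :: "(nat \<Rightarrow> nat) \<Rightarrow> nat set \<Rightarrow> nat set \<Rightarrow> bool" where
  "many_one_reduction f A B \<longleftrightarrow> computable f \<and> (\<forall>x. x \<in> A \<longleftrightarrow> f x \<in> B)"

definition many_one_reducible :: "nat set \<Rightarrow> nat set \<Rightarrow> bool" (infix \<open>\<le>\<^sub>m\<close> 50) where
  "A \<le>\<^sub>m B \<longleftrightarrow> (\<exists>f. many_one_reduction f A B)"


section \<open>Deterministic finite automata\<close>

text \<open>The states of \<open>DFA q0 T F\<close> are the row indices of the transition table \<open>T\<close>, whose entry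
  \<open>T ! q ! a\<close> is the successor of the state \<open>q\<close> under the letter \<open>a\<close>.\<close>

datatype dfa = DFA (start: nat) (table: "nat list list") (finals: "nat list")

definition is_dfa :: "nat \<Rightarrow> dfa \<Rightarrow> bool" where
  "is_dfa k M \<longleftrightarrow>
     start M < length (table M) \<and>
     (\<forall>row \<in> set (table M). length row = k \<and> set row \<subseteq> {..<length (table M)}) \<and>
     set (finals M) \<subseteq> {..<length (table M)}"

definition run :: "dfa \<Rightarrow> nat \<Rightarrow> nat list \<Rightarrow> nat" where
  "run M q u = foldl (\<lambda>p a. table M ! p ! a) q u"

definition lang :: "nat \<Rightarrow> dfa \<Rightarrow> nat list set" where
  "lang k M = {u \<in> lists {..<k}. run M (start M) u \<in> set (finals M)}"

definition regular :: "nat \<Rightarrow> nat list set \<Rightarrow> bool" where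
  "regular k R \<longleftrightarrow> (\<exists>M. is_dfa k M \<and> lang k M = R)"

definition encode_dfa :: "dfa \<Rightarrow> nat" where
  "encode_dfa M =
     list_encode [start M, list_encode (map list_encode (table M)), list_encode (finals M)]"

lemma inj_encode_dfa: "inj encode_dfa"
proof (rule injI)
  fix M N assume "encode_dfa M = encode_dfa N"
  then have "start M = start N" "map list_encode (table M) = map list_encode (table N)"
      "finals M = finals N"
    by (simp_all add: encode_dfa_def list_encode_eq)
  then show "M = N"
    using inj_list_encode[of UNIV] by (metis dfa.expand inj_map_eq_map)
qed


section \<open>Infinite words and the decision problems\<close>

definition Pref :: "'a stream \<Rightarrow> 'a list set" where
  "Pref W = {stake n W | n. True}"

definition factor :: "'a list \<Rightarrow> 'a stream \<Rightarrow> bool" where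
  "factor u W \<longleftrightarrow> (\<exists>i. stake (length u) (sdrop i W) = u)"

text \<open>A problem is the set of the codes of its positive instances, so a number that is not the
  code of an automaton over the given alphabet counts as a negative instance.\<close>

definition RR :: "nat \<Rightarrow> nat list set \<Rightarrow> nat set" where
  "RR k L = {encode_dfa M | M. is_dfa k M \<and> L \<inter> lang k M \<noteq> {}}"

definition Rp :: "nat \<Rightarrow> nat stream \<Rightarrow> nat set" where
  "Rp k W = RR k (Pref W)"

lemma encode_dfa_in_RR_iff: "encode_dfa M \<in> RR k L \<longleftrightarrow> is_dfa k M \<and> L \<inter> lang k M \<noteq> {}"
  using inj_encode_dfa by (auto simp: RR_def dest: injD)

text \<open>The image of an infinite word under the morphism extending \<open>h\<close>.  It is meaningful only when
  no \<open>h a\<close> is empty, see the lemma below.\<close>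

definition morph_stream :: "('a \<Rightarrow> 'b list) \<Rightarrow> 'a stream \<Rightarrow> 'b stream" where
  "morph_stream h W = flat (smap h W)"

lemma morph_stream_shift:
  assumes "\<And>a. h a \<noteq> []"
  shows "morph_stream h W = concat (map h (stake n W)) @- morph_stream h (sdrop n W)"
proof (induction n arbitrary: W)
  case (Suc n)
  have "morph_stream h W = h (shd W) @- morph_stream h (stl W)"
    unfolding morph_stream_def using flat_unfold[of "smap h W"] assms by simp
  then show ?case
    using Suc[of "stl W"] by simp
qed simp


section \<open>The language transformation\<close>

definition conc :: "'a list set \<Rightarrow> 'a list set \<Rightarrow> 'a list set" where
  "conc A B = {u @ v | u v. u \<in> A \<and> v \<in> B}"

definition star :: "'a list set \<Rightarrow> 'a list set" where
  "star A = {concat us | us. us \<in> lists A}"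

definition tilde :: "nat list set \<Rightarrow> nat list set" where
  "tilde R = conc (star (conc (lists {..<2}) {[hash]})) (conc R {[hash]})"

end

(*
  Replace M by the automaton that stops at its first final state.  Whether some w_i # leads from a
  state q to a final state or out of a set S of states is a single query to RR(L).  Reading W block
  by block, search either for a final state or for a list S that contains the current state and that,
  by these queries, can neither be left nor produce a final state.  The search ends: treating the
  states one by one yields a word u over the infinite alphabet that leads every state to a final
  state or to a state from which none is reachable, and u occurs in W_inf.
*)
theory Submission
  imports Defs
begin

text \<open>No bound on how much of W must be read is computed in advance, so the decision is an
  unbounded search, and a negative answer needs a finite certificate. The list \<open>S\<close> is
  one: that it cannot be left by a single block costs one query per entry, and induction over blocks
  extends this to everything W may still contain. Guessing \<open>S\<close> along with the number of
  blocks read replaces a computation of which states reach which.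

  Minimisation is available for total searches only, so termination must be proved. The state in
  which the run arrives at an occurrence of \<open>u\<close> depends on where \<open>u\<close>
  occurs in \<open>W_inf\<close>; hence \<open>u\<close> cannot be tailored to one state and has to
  serve all of them.

  Stopping at final states allows the run to be inspected after whole blocks only: an acceptance
  inside a block is still visible at its end.

  The class \<open>recursive_in\<close> speaks of number lists of fixed length. Bijective codes
  carry it over to functions on pairs and lists, whose effectiveness is then derived rule by rule
  from \<open>effective_intros\<close>.\<close>

section \<open>Recursive functions\<close>

text \<open>Closure of \<^const>\<open>recursive_in\<close> under changing values on lists of the wrong length.\<close>

definition rec_on :: "nat set \<Rightarrow> nat \<Rightarrow> (nat list \<Rightarrow> nat) \<Rightarrow> bool" where
  "rec_on A n f \<longleftrightarrow> (\<exists>F. recursive_in A n F \<and> (\<forall>xs. length xs = n \<longrightarrow> F xs = f xs))"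

lemma rec_onI: "recursive_in A n f \<Longrightarrow> rec_on A n f"
  unfolding rec_on_def by blast

lemma rec_on_cong:
  assumes "rec_on A n f" and "\<And>xs. length xs = n \<Longrightarrow> f xs = g xs"
  shows "rec_on A n g"
  using assms unfolding rec_on_def by metis

lemma computable_in_iff_rec_on: "computable_in A f \<longleftrightarrow> rec_on A 1 (\<lambda>xs. f (hd xs))"
proof -
  have "(\<forall>x. F [x] = f x) \<longleftrightarrow> (\<forall>xs. length xs = 1 \<longrightarrow> F xs = f (hd xs))" for F
    by (auto simp: length_Suc_conv)
  then show ?thesis
    unfolding computable_in_def rec_on_def by simp
qed

lemma rec_on_proj: "i < n \<Longrightarrow> rec_on A n (\<lambda>xs. xs ! i)"
  by (intro rec_onI proj)

lemma rec_on_zero: "rec_on A n (\<lambda>xs. 0)"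
  by (intro rec_onI zero)

lemma rec_on_comp:
  assumes f: "rec_on A (length gs) f" and gs: "\<forall>g \<in> set gs. rec_on A n g"
  shows "rec_on A n (\<lambda>xs. f (map (\<lambda>g. g xs) gs))"
proof -
  obtain F where F: "recursive_in A (length gs) F" "\<And>xs. length xs = length gs \<Longrightarrow> F xs = f xs"
    using f unfolding rec_on_def by blast
  obtain G where G: "\<And>g. g \<in> set gs \<Longrightarrow> recursive_in A n (G g)"
      "\<And>g xs. g \<in> set gs \<Longrightarrow> length xs = n \<Longrightarrow> G g xs = g xs"
    using gs unfolding rec_on_def by metis
  have "recursive_in A n (\<lambda>xs. F (map (\<lambda>g. g xs) (map G gs)))"
    using F(1) G(1) by (intro recursive_in.comp) auto
  moreover have "F (map (\<lambda>g. g xs) (map G gs)) = f (map (\<lambda>g. g xs) gs)" if "length xs = n" for xs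
  proof -
    have "map (\<lambda>g. g xs) (map G gs) = map (\<lambda>g. g xs) gs"
      using G(2) that by simp
    then show ?thesis
      using F(2)[of "map (\<lambda>g. g xs) gs"] by (simp only: length_map)
  qed
  ultimately show ?thesis
    unfolding rec_on_def by blast
qed

lemma rec_on_comp1:
  assumes "rec_on A 1 (\<lambda>xs. f (hd xs))" and "rec_on A n g"
  shows "rec_on A n (\<lambda>xs. f (g xs))"
  using rec_on_comp[of A "[g]" "\<lambda>xs. f (hd xs)" n] assms by simp

lemma rec_on_Suc:
  assumes "rec_on A n f"
  shows "rec_on A n (\<lambda>xs. Suc (f xs))"
  by (rule rec_on_comp1[OF rec_onI[OF recursive_in.suc] assms])

lemma rec_on_const: "rec_on A n (\<lambda>xs. c)"
  by (induction c) (auto intro: rec_on_zero rec_on_Suc)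

lemma map_nth_upt: "length xs = n \<Longrightarrow> map ((!) xs) [0..<n] = xs"
  using map_nth by blast

text \<open>Compared with \<open>prim_rec\<close>, the number of rounds may be any computed value.
  It is fed in by composing with \<open>h\<close> followed by all projections, which leaves
  \<open>xs\<close> itself as the parameter list.\<close>

lemma rec_on_rec_nat:
  assumes "rec_on A n a" and "rec_on A (Suc (Suc n)) g" and "rec_on A n h"
  shows "rec_on A n (\<lambda>xs. rec_nat (a xs) (\<lambda>k r. g (k # r # xs)) (h xs))"
proof -
  obtain F where F: "recursive_in A n F" "\<And>xs. length xs = n \<Longrightarrow> F xs = a xs"
    using assms(1) unfolding rec_on_def by blast
  obtain G where G: "recursive_in A (Suc (Suc n)) G"
      "\<And>xs. length xs = Suc (Suc n) \<Longrightarrow> G xs = g xs"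
    using assms(2) unfolding rec_on_def by blast
  have "rec_on A (Suc n) (\<lambda>xs. rec_nat (a (tl xs)) (\<lambda>k r. g (k # r # tl xs)) (hd xs))"
    using rec_onI[OF recursive_in.prim_rec[OF F(1) G(1)]]
    by (rule rec_on_cong) (simp add: F(2) G(2))
  then have "rec_on A n (\<lambda>xs. (\<lambda>xs. rec_nat (a (tl xs)) (\<lambda>k r. g (k # r # tl xs)) (hd xs))
      (map (\<lambda>g. g xs) (h # map (\<lambda>i xs. xs ! i) [0..<n])))"
    using assms(3) by (intro rec_on_comp) (auto intro: rec_on_proj)
  then show ?thesis
    by (rule rec_on_cong) (simp add: map_nth_upt comp_def)
qed

lemma rec_on_Least:
  assumes "rec_on A (Suc n) f" and "\<And>xs. length xs = n \<Longrightarrow> \<exists>k. f (k # xs) = 0"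
  shows "rec_on A n (\<lambda>xs. LEAST k. f (k # xs) = 0)"
proof -
  obtain F where F: "recursive_in A (Suc n) F" "\<And>xs. length xs = Suc n \<Longrightarrow> F xs = f xs"
    using assms(1) unfolding rec_on_def by blast
  have "recursive_in A n (\<lambda>xs. LEAST k. F (k # xs) = 0)"
    using F assms(2) by (intro recursive_in.minimise) simp_all
  from rec_onI[OF this] show ?thesis
    by (rule rec_on_cong) (simp add: F(2))
qed

text \<open>Induction over the construction of \<open>f\<close>: only the oracle case refers to
  \<open>B\<close>, and there the assumption supplies a substitute computed from
  \<open>A\<close>.\<close>

lemma rec_on_relative:
  assumes B: "computable_in A (\<lambda>x. if x \<in> B then 1 else 0)"
  shows "recursive_in B n f \<Longrightarrow> rec_on A n f"
proof (induction rule: recursive_in.induct)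
  case oracle_set
  show ?case
    using B unfolding computable_in_iff_rec_on .
next
  case (comp gs f n)
  then show ?case
    by (intro rec_on_comp) auto
next
  case (prim_rec n f g)
  \<comment> \<open>\<open>rec_on_rec_nat\<close> keeps the recursion argument among the parameters,
    so \<open>f\<close> and \<open>g\<close> are given one more argument that they ignore: index 0
    here, index 2 below, after \<open>k\<close> and \<open>r\<close>.\<close>
  have "rec_on A (Suc n) (\<lambda>xs. f (map (\<lambda>g. g xs) (map (\<lambda>i xs. xs ! Suc i) [0..<n])))"
    using prim_rec by (intro rec_on_comp) (auto intro: rec_on_proj)
  then have 1: "rec_on A (Suc n) (\<lambda>xs. f (tl xs))"
    by (rule rec_on_cong) (auto simp: length_Suc_conv comp_def map_nth_upt)
  have "rec_on A (Suc (Suc (Suc n))) (\<lambda>xs. g (map (\<lambda>g. g xs)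
      ((\<lambda>xs. xs ! 0) # (\<lambda>xs. xs ! 1) # map (\<lambda>i xs. xs ! (3 + i)) [0..<n])))"
    using prim_rec by (intro rec_on_comp) (auto intro: rec_on_proj)
  then have 2: "rec_on A (Suc (Suc (Suc n))) (\<lambda>xs. g (hd xs # hd (tl xs) # tl (tl (tl xs))))"
    by (rule rec_on_cong) (auto simp: length_Suc_conv comp_def map_nth_upt numeral_3_eq_3)
  have "rec_on A (Suc n) (\<lambda>xs. xs ! 0)"
    by (rule rec_on_proj) simp
  from rec_on_rec_nat[OF 1 2 this] show ?case
    by (rule rec_on_cong) (auto simp: length_Suc_conv)
next
  case (minimise n f)
  then show ?case
    by (intro rec_on_Least) auto
qed (simp_all add: rec_on_zero rec_on_proj rec_onI recursive_in.suc[simplified])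

lemma computable_in_trans:
  assumes "computable_in B f" and "computable_in A (\<lambda>x. if x \<in> B then 1 else 0)"
  shows "computable_in A f"
proof -
  obtain F where F: "recursive_in B 1 F" "\<And>x. F [x] = f x"
    using assms(1) unfolding computable_in_def by blast
  from rec_on_relative[OF assms(2) F(1)] show ?thesis
    unfolding computable_in_iff_rec_on
    by (rule rec_on_cong) (auto simp: length_Suc_conv F(2))
qed

lemma computable_imp_computable_in:
  assumes "computable f"
  shows "computable_in A f"
proof (rule computable_in_trans)
  show "computable_in {} f"
    using assms unfolding computable_def .
  show "computable_in A (\<lambda>x. if x \<in> {} then 1 else 0)"
    by (simp add: computable_in_iff_rec_on rec_on_zero)
qed


subsection \<open>Arithmetic and pairing\<close>

lemma rec_on_add:
  assumes "rec_on A n f" and "rec_on A n g"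
  shows "rec_on A n (\<lambda>xs. f xs + g xs)"
proof -
  have "rec_on A n (\<lambda>xs. rec_nat (g xs) (\<lambda>k r. Suc ((k # r # xs) ! 1)) (f xs))"
    using assms by (intro rec_on_rec_nat rec_on_Suc rec_on_proj) simp_all
  moreover have "rec_nat b (\<lambda>k. Suc) a = a + b" for a b :: nat
    by (induction a) simp_all
  ultimately show ?thesis
    by (simp add: eta_contract_eq)
qed

lemma rec_on_diff:
  assumes "rec_on A n f" and "rec_on A n g"
  shows "rec_on A n (\<lambda>xs. f xs - g xs)"
proof -
  have pred: "rec_on A m (\<lambda>xs. h xs - 1)" if "rec_on A m h" for m h
  proof -
    have "rec_on A m (\<lambda>xs. rec_nat 0 (\<lambda>k r. (k # r # xs) ! 0) (h xs))"
      using that by (intro rec_on_rec_nat rec_on_zero rec_on_proj) simp_all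
    moreover have "rec_nat 0 (\<lambda>k r. k) a = a - 1" for a :: nat
      by (cases a) simp_all
    ultimately show ?thesis
      by simp
  qed
  have "rec_on A n (\<lambda>xs. rec_nat (f xs) (\<lambda>k r. (k # r # xs) ! 1 - 1) (g xs))"
    using assms by (intro rec_on_rec_nat pred rec_on_proj) simp_all
  moreover have "rec_nat a (\<lambda>k r. r - 1) b = a - b" for a b :: nat
    by (induction b) simp_all
  ultimately show ?thesis
    by simp
qed

lemma rec_on_triangle:
  assumes "rec_on A n f"
  shows "rec_on A n (\<lambda>xs. triangle (f xs))"
proof -
  have "rec_on A n (\<lambda>xs. rec_nat 0 (\<lambda>k r. (k # r # xs) ! 1 + Suc ((k # r # xs) ! 0)) (f xs))"
    using assms by (intro rec_on_rec_nat rec_on_add rec_on_Suc rec_on_zero rec_on_proj) simp_all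
  moreover have "rec_nat 0 (\<lambda>k r. r + Suc k) a = triangle a" for a :: nat
    by (induction a) simp_all
  ultimately show ?thesis
    by simp
qed

lemma rec_on_prod_encode:
  assumes "rec_on A n f" and "rec_on A n g"
  shows "rec_on A n (\<lambda>xs. prod_encode (f xs, g xs))"
  unfolding prod_encode_def using assms by (simp add: rec_on_add rec_on_triangle)

text \<open>For \<open>c = prod_encode (a, b)\<close>, that is \<open>triangle (a + b) + a\<close>,
  this is the index \<open>a + b\<close> of the antidiagonal of \<open>c\<close>. The condition says
  \<open>c < triangle (Suc k)\<close>, written as a truncated difference because minimisation looks
  for a zero.\<close>

definition diagonal :: "nat \<Rightarrow> nat" where
  "diagonal c = (LEAST k. Suc c - triangle (Suc k) = 0)"

lemma diagonal_prod_encode: "diagonal (prod_encode (a, b)) = a + b"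
  unfolding diagonal_def
proof (rule Least_equality)
  fix k assume k: "Suc (prod_encode (a, b)) - triangle (Suc k) = 0"
  have mono: "triangle i \<le> triangle j" if "i \<le> j" for i j
    using that by (induction rule: dec_induct) simp_all
  show "a + b \<le> k"
    using k mono[of "Suc k" "a + b"] by (force simp: prod_encode_def not_le)
qed (simp add: prod_encode_def)

lemma rec_on_diagonal:
  assumes "rec_on A n f"
  shows "rec_on A n (\<lambda>xs. diagonal (f xs))"
proof (rule rec_on_comp1[OF _ assms])
  \<comment> \<open>With this bound \<open>k = c\<close> always meets the condition, so the
    minimisation is regular.\<close>
  have le: "k \<le> triangle k" for k
    by (induction k) simp_all
  have "\<exists>k. Suc c - triangle (Suc k) = 0" for c
    using le[of "Suc c"] by (metis diff_is_0_eq)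
  then have "rec_on A 1 (\<lambda>xs. LEAST k. Suc ((k # xs) ! 1) - triangle (Suc ((k # xs) ! 0)) = 0)"
    by (intro rec_on_Least rec_on_diff rec_on_triangle rec_on_Suc rec_on_proj) simp_all
  then show "rec_on A 1 (\<lambda>xs. diagonal (hd xs))"
    unfolding diagonal_def by (rule rec_on_cong) (auto simp: length_Suc_conv)
qed

lemma prod_decode_diagonal:
  "prod_decode c = (c - triangle (diagonal c), diagonal c - (c - triangle (diagonal c)))"
proof -
  obtain a b where c: "c = prod_encode (a, b)"
    by (metis prod_decode_inverse surj_pair)
  then have "diagonal c = a + b" "c - triangle (a + b) = a" "prod_decode c = (a, b)"
    by (simp_all only: diagonal_prod_encode prod_encode_inverse) (simp add: prod_encode_def)
  then show ?thesis
    by simp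
qed

lemma rec_on_prod_decode:
  assumes "rec_on A n f"
  shows "rec_on A n (\<lambda>xs. fst (prod_decode (f xs)))" and "rec_on A n (\<lambda>xs. snd (prod_decode (f xs)))"
  using assms by (simp_all add: prod_decode_diagonal rec_on_diff rec_on_triangle rec_on_diagonal)


section \<open>Computability on coded types\<close>

text \<open>Codes are bijective so that every number decodes: functions on codes need no validity
  test, and a search through all numbers is a search through all values.\<close>

class coded =
  fixes enc :: "'a \<Rightarrow> nat"
  assumes bij_enc: "bij enc"

definition dec :: "nat \<Rightarrow> 'a::coded" where
  "dec = inv enc"

lemma dec_enc [simp]: "dec (enc x) = x"
  unfolding dec_def using bij_is_inj[OF bij_enc] by (rule inv_f_f)

lemma enc_dec [simp]: "enc (dec n :: 'a::coded) = n"
  unfolding dec_def using bij_is_surj[OF bij_enc] by (rule surj_f_inv_f)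

lemma enc_eq_iff [simp]: "enc x = enc y \<longleftrightarrow> x = y"
  by (metis dec_enc)

lemma bij_if_inverse: "(\<And>x. g (f x) = x) \<Longrightarrow> (\<And>y. f (g y) = y) \<Longrightarrow> bij f"
  by (metis bij_def inj_def surj_def)

instantiation nat :: coded
begin
definition enc_nat :: "nat \<Rightarrow> nat" where
  enc_nat [simp]: "enc_nat n = n"
instance
  by standard (simp add: bij_if_inverse[of id])
end

instantiation prod :: (coded, coded) coded
begin
definition enc_prod :: "'a \<times> 'b \<Rightarrow> nat" where
  "enc_prod p = prod_encode (enc (fst p), enc (snd p))"
instance
proof
  show "bij (enc :: 'a \<times> 'b \<Rightarrow> nat)"
    by (rule bij_if_inverse[of "\<lambda>c. map_prod dec dec (prod_decode c)"])
      (simp_all add: enc_prod_def)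
qed
end

instantiation list :: (coded) coded
begin
definition enc_list :: "'a list \<Rightarrow> nat" where
  "enc_list xs = list_encode (map enc xs)"
instance
proof
  show "bij (enc :: 'a list \<Rightarrow> nat)"
    by (rule bij_if_inverse[of "\<lambda>c. map dec (list_decode c)"])
      (simp_all add: enc_list_def comp_def)
qed
end

lemma dec_nat [simp]: "dec n = n"
  using enc_dec[of n, where 'a = nat] by (simp del: enc_dec)

lemma dec_prod: "dec c = (dec (fst (prod_decode c)), dec (snd (prod_decode c)))"
  by (metis dec_enc enc_dec enc_prod_def fst_conv prod_encode_inverse snd_conv surj_pair)

lemma enc_Nil [simp]: "enc ([] :: 'a::coded list) = 0"
  by (simp add: enc_list_def)

lemma enc_Cons [simp]: "enc (x # xs) = Suc (prod_encode (enc x, enc xs))"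
  by (simp add: enc_list_def)

text \<open>The link between these codes and the \<open>list_encode\<close> by which automata and
  the words \<open>w i\<close> are coded.\<close>

lemma enc_nat_list: "enc (xs :: nat list) = list_encode xs"
proof -
  have "map enc xs = xs"
    by (induction xs) simp_all
  then show ?thesis
    by (simp add: enc_list_def)
qed

definition effective :: "nat set \<Rightarrow> ('a::coded \<Rightarrow> 'b::coded) \<Rightarrow> bool" where
  "effective A f \<longleftrightarrow> computable_in A (\<lambda>n. enc (f (dec n)))"

definition effective_pred :: "nat set \<Rightarrow> ('a::coded \<Rightarrow> bool) \<Rightarrow> bool" where
  "effective_pred A P \<longleftrightarrow> effective A (\<lambda>x. of_bool (P x) :: nat)"


section \<open>Closure properties of effective functions and predicates\<close>

lemma effective_comp:
  assumes "effective A f" and "effective A g"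
  shows "effective A (\<lambda>x. f (g x))"
proof -
  have "computable_in A (\<lambda>n. (\<lambda>n. enc (f (dec n))) (enc (g (dec n))))"
    using assms unfolding effective_def computable_in_iff_rec_on by (rule rec_on_comp1)
  then show ?thesis
    unfolding effective_def by simp
qed

lemma rec_on_hd: "rec_on A 1 hd"
  by (rule rec_on_cong[OF rec_on_proj[of 0]]) (auto simp: length_Suc_conv)

lemma effective_codeI:
  assumes "rec_on A 1 (\<lambda>xs. F (hd xs))" and "\<And>x. F (enc x) = enc (f x)"
  shows "effective A f"
proof -
  have "F n = enc (f (dec n))" for n
    using assms(2)[of "dec n"] by simp
  then show ?thesis
    using assms(1) unfolding effective_def computable_in_iff_rec_on by simp
qed

text \<open>Turns a closure rule for \<open>rec_on\<close> into one for \<open>effective\<close>: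
  applied to \<open>hd\<close>, the rule yields the function \<open>F\<close> on codes
  itself.\<close>

lemma effective_unary:
  assumes "\<And>a. rec_on A 1 a \<Longrightarrow> rec_on A 1 (\<lambda>xs. F (a xs))" and "\<And>x. F (enc x) = enc (f x)"
    and "effective A g"
  shows "effective A (\<lambda>x. f (g x))"
  using effective_codeI[OF assms(1)[OF rec_on_hd] assms(2)] assms(3) by (rule effective_comp)

named_theorems effective_intros

lemma effective_id [effective_intros]: "effective A (\<lambda>x. x)"
  using rec_on_hd by (rule effective_codeI) simp

lemma effective_const [effective_intros]: "effective A (\<lambda>x. c)"
  using rec_on_const by (rule effective_codeI) simp

lemma effective_enc [effective_intros]: "effective A f \<Longrightarrow> effective A (\<lambda>x. enc (f x))"
  by (rule effective_unary[where F = "\<lambda>n. n"]) simp_all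

lemma effective_dec [effective_intros]: "effective A f \<Longrightarrow> effective A (\<lambda>x. dec (f x))"
  by (rule effective_unary[where F = "\<lambda>n. n"]) simp_all

lemma effective_Pair [effective_intros]:
  assumes "effective A f" and "effective A g"
  shows "effective A (\<lambda>x. (f x, g x))"
  using assms unfolding effective_def computable_in_iff_rec_on by (simp add: enc_prod_def rec_on_prod_encode)

lemma effective_fst [effective_intros]: "effective A f \<Longrightarrow> effective A (\<lambda>x. fst (f x))"
  by (rule effective_unary[where F = "\<lambda>n. fst (prod_decode n)"])
    (erule rec_on_prod_decode, unfold enc_prod_def prod_encode_inverse, simp_all)

lemma effective_snd [effective_intros]: "effective A f \<Longrightarrow> effective A (\<lambda>x. snd (f x))"
  by (rule effective_unary[where F = "\<lambda>n. snd (prod_decode n)"])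
    (erule rec_on_prod_decode, unfold enc_prod_def prod_encode_inverse, simp_all)

lemma effective_Suc [effective_intros]: "effective A f \<Longrightarrow> effective A (\<lambda>x. Suc (f x))"
  by (rule effective_unary[where f = Suc, OF rec_on_Suc]) simp_all

lemma effective_diff [effective_intros]:
  fixes f g :: "'a::coded \<Rightarrow> nat"
  assumes "effective A f" and "effective A g"
  shows "effective A (\<lambda>x. f x - g x)"
  using assms unfolding effective_def computable_in_iff_rec_on by (simp add: rec_on_diff)

lemma effective_rec_nat [effective_intros]:
  assumes a: "effective A a"
    and g: "effective A (\<lambda>z. g (fst z) (fst (snd z)) (snd (snd z)))"
    and h: "effective A h"
  shows "effective A (\<lambda>x. rec_nat (a x) (g x) (h x))"
proof -
  \<comment> \<open>\<open>effective\<close> concerns one argument, so the step function reads the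
    nested pair of \<open>x\<close>, the round \<open>k\<close> and the value \<open>r\<close>. In
    the list \<open>k # r # xs\<close> below these are the entries 2, 0 and 1.\<close>
  define G where "G c = enc (g (dec (fst (prod_decode c))) (fst (prod_decode (snd (prod_decode c))))
    (dec (snd (prod_decode (snd (prod_decode c))))))" for c
  have "rec_on A 1 (\<lambda>xs. G (hd xs))"
    using g unfolding effective_def computable_in_iff_rec_on G_def
    by (simp add: dec_prod[where 'b = "nat \<times> 'b"] dec_prod[where 'a = nat])
  then have "rec_on A 3 (\<lambda>ys. G (prod_encode (ys ! 2, prod_encode (ys ! 0, ys ! 1))))"
    by (rule rec_on_comp1) (intro rec_on_prod_encode rec_on_proj; simp)
  then have "rec_on A 1 (\<lambda>xs. rec_nat (enc (a (dec (hd xs))))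
      (\<lambda>k r. G (prod_encode ((k # r # xs) ! 2, prod_encode ((k # r # xs) ! 0, (k # r # xs) ! 1))))
      (enc (h (dec (hd xs)))))"
    using a h unfolding effective_def computable_in_iff_rec_on
    by (intro rec_on_rec_nat) (simp_all add: numeral_3_eq_3)
  moreover have "rec_nat (enc (a (dec n))) (\<lambda>k r. G (prod_encode (n, prod_encode (k, r)))) m
      = enc (rec_nat (a (dec n)) (g (dec n)) m)" for n m
    by (induction m) (simp_all add: G_def)
  ultimately show ?thesis
    unfolding effective_def computable_in_iff_rec_on
    by (elim rec_on_cong) (auto simp: length_Suc_conv)
qed

text \<open>Predicates are treated through their \<^typ>\<open>nat\<close>-valued characteristic functions because
  \<^typ>\<open>bool\<close>, being finite, cannot be put in bijection with the codes.\<close>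

lemma effective_if [effective_intros]:
  assumes "effective_pred A P" and "effective A f" and "effective A g"
  shows "effective A (\<lambda>x. if P x then f x else g x)"
proof -
  \<comment> \<open>The truth value is the number of rounds: none leaves \<open>g x\<close>, one
    replaces it by \<open>f x\<close>.\<close>
  have "effective A (\<lambda>x. rec_nat (g x) (\<lambda>k r. f x) (of_bool (P x)))"
    using assms(1) unfolding effective_pred_def
    by (intro effective_rec_nat effective_comp[OF assms(2)] assms(3) effective_fst effective_id)
  moreover have "rec_nat (g x) (\<lambda>k r. f x) (of_bool (P x)) = (if P x then f x else g x)" for x
    by simp
  ultimately show ?thesis
    by simp
qed

lemma effective_pred_eq_0:
  fixes f :: "'a::coded \<Rightarrow> nat"
  assumes "effective A f"
  shows "effective_pred A (\<lambda>x. f x = 0)"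
proof -
  have "effective A (\<lambda>x. 1 - f x)"
    by (intro effective_intros assms)
  moreover have "1 - f x = of_bool (f x = 0)" for x
    by simp
  ultimately show ?thesis
    unfolding effective_pred_def by simp
qed

lemma effective_pred_le:
  fixes f g :: "'a::coded \<Rightarrow> nat"
  assumes "effective A f" and "effective A g"
  shows "effective_pred A (\<lambda>x. f x \<le> g x)"
  using effective_pred_eq_0[OF effective_diff[OF assms]] by simp

lemma effective_pred_less [effective_intros]:
  fixes f g :: "'a::coded \<Rightarrow> nat"
  assumes "effective A f" and "effective A g"
  shows "effective_pred A (\<lambda>x. f x < g x)"
  using effective_pred_le[OF effective_Suc[OF assms(1)] assms(2)] by (simp add: Suc_le_eq)

lemma effective_pred_const: "effective_pred A (\<lambda>x. c)"
  unfolding effective_pred_def by (rule effective_const)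

lemma effective_pred_comp:
  assumes "effective_pred A P" and "effective A f"
  shows "effective_pred A (\<lambda>x. P (f x))"
  using assms unfolding effective_pred_def by (rule effective_comp)

lemma effective_pred_if:
  assumes "effective_pred A P" and "effective_pred A Q" and "effective_pred A R"
  shows "effective_pred A (\<lambda>x. if P x then Q x else R x)"
proof -
  have "effective A (\<lambda>x. if P x then of_bool (Q x) else of_bool (R x) :: nat)"
    using assms by (intro effective_if) (simp_all add: effective_pred_def)
  moreover have "(if P x then of_bool (Q x) else of_bool (R x)) = (of_bool (if P x then Q x else R x) :: nat)" for x
    by simp
  ultimately show ?thesis
    unfolding effective_pred_def by simp
qed

lemma effective_pred_not [effective_intros]:
  assumes "effective_pred A P"
  shows "effective_pred A (\<lambda>x. \<not> P x)"
proof -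
  have "effective_pred A (\<lambda>x. if P x then False else True)"
    by (intro effective_pred_if effective_pred_const assms)
  also have "(\<lambda>x. if P x then False else True) = (\<lambda>x. \<not> P x)"
    by auto
  finally show ?thesis .
qed

lemma effective_pred_conj [effective_intros]:
  assumes "effective_pred A P" and "effective_pred A Q"
  shows "effective_pred A (\<lambda>x. P x \<and> Q x)"
proof -
  have "effective_pred A (\<lambda>x. if P x then Q x else False)"
    by (intro effective_pred_if effective_pred_const assms)
  also have "(\<lambda>x. if P x then Q x else False) = (\<lambda>x. P x \<and> Q x)"
    by auto
  finally show ?thesis .
qed

lemma effective_pred_disj [effective_intros]:
  assumes "effective_pred A P" and "effective_pred A Q"
  shows "effective_pred A (\<lambda>x. P x \<or> Q x)"
proof -
  have "effective_pred A (\<lambda>x. \<not> (\<not> P x \<and> \<not> Q x))"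
    by (intro effective_pred_not effective_pred_conj assms)
  then show ?thesis
    by simp
qed

lemma effective_pred_eq [effective_intros]:
  assumes "effective A f" and "effective A g"
  shows "effective_pred A (\<lambda>x. f x = g x)"
proof -
  have "effective_pred A (\<lambda>x. enc (f x) \<le> enc (g x) \<and> enc (g x) \<le> enc (f x))"
    using assms by (intro effective_pred_conj effective_pred_le effective_enc)
  then show ?thesis
    by (simp flip: eq_iff)
qed

lemma effective_pred_oracle:
  fixes f :: "'a::coded \<Rightarrow> nat"
  assumes "effective A f"
  shows "effective_pred A (\<lambda>x. f x \<in> A)"
proof (rule effective_pred_comp[OF _ assms])
  have "rec_on A 1 (\<lambda>xs. if hd xs \<in> A then 1 else 0)"
    by (rule rec_onI[OF oracle_set])
  then show "effective_pred A (\<lambda>n. n \<in> A)"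
    unfolding effective_pred_def by (rule effective_codeI) simp
qed

lemma effective_Least:
  assumes "effective_pred A (\<lambda>z. P (fst z) (snd z))" and "\<And>x. \<exists>k::nat. P x k"
  shows "effective A (\<lambda>x. LEAST k. P x k)"
proof -
  \<comment> \<open>Negated, because minimisation looks for a zero.\<close>
  have "rec_on A 1 (\<lambda>xs. of_bool (\<not> P (dec (fst (prod_decode (hd xs)))) (snd (prod_decode (hd xs)))))"
    using effective_pred_not[OF assms(1)]
    unfolding effective_pred_def effective_def computable_in_iff_rec_on
    by (simp add: dec_prod[where 'b = nat])
  \<comment> \<open>Minimisation puts the search variable first, whereas \<open>P\<close> takes it
    second.\<close>
  then have "rec_on A 2 (\<lambda>ys. (\<lambda>c. of_bool (\<not> P (dec (fst (prod_decode c))) (snd (prod_decode c))))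
      (prod_encode (ys ! 1, ys ! 0)))"
    by (rule rec_on_comp1) (intro rec_on_prod_encode rec_on_proj; simp)
  then have "rec_on A (Suc 1) (\<lambda>ys. of_bool (\<not> P (dec (ys ! 1)) (ys ! 0)))"
    by (simp add: numeral_2_eq_2)
  from rec_on_Least[OF this]
  have "rec_on A 1 (\<lambda>xs. LEAST k. of_bool (\<not> P (dec (xs ! 0)) k) = (0 :: nat))"
    using assms(2) by simp
  then have "rec_on A 1 (\<lambda>xs. LEAST k. P (dec (hd xs)) k)"
    by (rule rec_on_cong) (auto simp: length_Suc_conv)
  then show ?thesis
    by (rule effective_codeI) simp
qed


subsection \<open>Lists\<close>

lemma effective_Cons [effective_intros]:
  assumes "effective A f" and "effective A g"
  shows "effective A (\<lambda>x. f x # g x)"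
proof -
  have "effective A (\<lambda>p. fst p # snd p)"
    by (rule effective_codeI[OF rec_on_Suc[OF rec_on_hd]]) (simp add: enc_prod_def)
  from effective_comp[OF this effective_Pair[OF assms]] show ?thesis
    by simp
qed

lemma effective_hd_tl:
  shows effective_hd: "effective A (hd :: 'a::coded list \<Rightarrow> 'a)"
    and effective_tl: "effective A (tl :: 'a::coded list \<Rightarrow> 'a list)"
proof -
  define s :: "'a list \<Rightarrow> 'a \<times> 'a list" where "s xs = dec (enc xs - 1)" for xs
  have s: "effective A s"
    unfolding s_def by (intro effective_intros)
  have s_Cons: "s (y # ys) = (y, ys)" for y ys
    using dec_enc[of "(y, ys)"] unfolding s_def by (simp add: enc_prod_def del: dec_enc)
  \<comment> \<open>\<open>hd []\<close> is unspecified but fixed, hence effective as a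
    constant.\<close>
  have "effective A (\<lambda>xs :: 'a list. if xs = [] then hd [] else fst (s xs))"
    by (intro effective_intros s)
  also have "(\<lambda>xs :: 'a list. if xs = [] then hd [] else fst (s xs)) = hd"
    by (auto simp: fun_eq_iff neq_Nil_conv s_Cons)
  finally show "effective A (hd :: 'a list \<Rightarrow> 'a)" .
  have "effective A (\<lambda>xs :: 'a list. if xs = [] then [] else snd (s xs))"
    by (intro effective_intros s)
  also have "(\<lambda>xs :: 'a list. if xs = [] then [] else snd (s xs)) = tl"
    by (auto simp: fun_eq_iff neq_Nil_conv s_Cons)
  finally show "effective A (tl :: 'a list \<Rightarrow> 'a list)" .
qed

lemmas effective_hd_of [effective_intros] = effective_comp[OF effective_hd]
  and effective_tl_of [effective_intros] = effective_comp[OF effective_tl]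

lemma length_le_enc: "length xs \<le> enc xs"
proof (induction xs)
  case (Cons x xs)
  then show ?case
    using le_prod_encode_2[of "enc xs" "enc x"] by simp
qed simp

text \<open>The fold is run for as many steps as the code of the list, which is at least its length.\<close>

lemma effective_foldl [effective_intros]:
  assumes s: "effective A (\<lambda>z. s (fst z) (fst (snd z)) (snd (snd z)))"
    and i: "effective A i" and l: "effective A l"
  shows "effective A (\<lambda>x. foldl (s x) (i x) (l x))"
proof -
  define step where "step x r = (if snd r = [] then r else (s x (fst r) (hd (snd r)), tl (snd r)))" for x r
  have s': "effective A (\<lambda>z. s (a z) (b z) (c z))"
    if "effective A a" "effective A b" "effective A c" for a b and c :: "'d::coded \<Rightarrow> _"
    using effective_comp[OF s effective_Pair[OF that(1) effective_Pair[OF that(2,3)]]] by simp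
  have "effective A (\<lambda>x. fst (rec_nat (i x, l x) (\<lambda>k r. step x r) (enc (l x))))"
    unfolding step_def by (intro effective_intros i l s')
  moreover have "rec_nat (a, xs) (\<lambda>k r. step x r) n = (foldl (s x) a (take n xs), drop n xs)" for x a xs n
    by (induction n) (auto simp: step_def take_hd_drop[symmetric] drop_Suc tl_drop[symmetric] not_le
        take_Suc_conv_app_nth hd_drop_conv_nth)
  ultimately show ?thesis
    by (simp add: length_le_enc)
qed

lemma effective_rev [effective_intros]:
  assumes "effective A l"
  shows "effective A (\<lambda>x. rev (l x))"
proof -
  have "effective A (\<lambda>x. foldl (\<lambda>ys y. y # ys) [] (l x))"
    by (intro effective_intros assms)
  then show ?thesis
    by (simp add: foldl_conv_fold rev_conv_fold)
qed

lemma effective_append [effective_intros]: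
  assumes "effective A f" and "effective A g"
  shows "effective A (\<lambda>x. f x @ g x)"
proof -
  have "effective A (\<lambda>x. foldl (\<lambda>ys y. y # ys) (g x) (rev (f x)))"
    by (intro effective_intros assms)
  moreover have "foldl (\<lambda>ys y. y # ys) ys (rev xs) = xs @ ys" for xs ys :: "'b list"
    by (induction xs arbitrary: ys) simp_all
  ultimately show ?thesis
    by simp
qed

lemma effective_length [effective_intros]:
  assumes "effective A l"
  shows "effective A (\<lambda>x. length (l x))"
proof -
  have "effective A (\<lambda>x. foldl (\<lambda>n y. Suc n) 0 (l x))"
    by (intro effective_intros assms)
  moreover have "foldl (\<lambda>n y. Suc n) k xs = k + length xs" for k and xs :: "'b list"
    by (induction xs arbitrary: k) simp_all
  ultimately show ?thesis
    by simp
qed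

lemma effective_drop [effective_intros]:
  assumes "effective A i" and "effective A l"
  shows "effective A (\<lambda>x. drop (i x) (l x))"
proof -
  have "effective A (\<lambda>x. rec_nat (l x) (\<lambda>k r. tl r) (i x))"
    by (intro effective_intros assms)
  moreover have "rec_nat xs (\<lambda>k r. tl r) n = drop n xs" for xs :: "'b list" and n
    by (induction n) (simp_all add: drop_Suc tl_drop)
  ultimately show ?thesis
    by simp
qed

lemma effective_upt [effective_intros]:
  assumes "effective A f"
  shows "effective A (\<lambda>x. [0..<f x])"
proof -
  have "effective A (\<lambda>x. rec_nat [] (\<lambda>k r. r @ [k]) (f x))"
    by (intro effective_intros assms)
  moreover have "rec_nat [] (\<lambda>k r. r @ [k]) n = [0..<n]" for n
    by (induction n) simp_all
  ultimately show ?thesis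
    by simp
qed

lemma effective_concat_map [effective_intros]:
  assumes "effective A (\<lambda>z. f (fst z) (snd z))" and "effective A l"
  shows "effective A (\<lambda>x. concat (map (f x) (l x)))"
proof -
  have f: "effective A (\<lambda>z. f (a z) (b z))" if "effective A a" "effective A b" for a and b :: "'d::coded \<Rightarrow> _"
    using effective_comp[OF assms(1) effective_Pair[OF that]] by simp
  have "effective A (\<lambda>x. foldl (\<lambda>ys y. ys @ f x y) [] (l x))"
    by (intro effective_intros f assms)
  moreover have "foldl (\<lambda>ys y. ys @ h y) [] xs = concat (map h xs)" for h :: "'b \<Rightarrow> 'c list" and xs
    by (induction xs rule: rev_induct) simp_all
  ultimately show ?thesis
    by simp
qed

lemma effective_map [effective_intros]:
  assumes "effective A (\<lambda>z. f (fst z) (snd z))" and "effective A l"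
  shows "effective A (\<lambda>x. map (f x) (l x))"
proof -
  have "effective A (\<lambda>x. concat (map (\<lambda>y. [f x y]) (l x)))"
    by (intro effective_intros assms)
  then show ?thesis
    by simp
qed

lemma effective_filter [effective_intros]:
  assumes "effective_pred A (\<lambda>z. P (fst z) (snd z))" and "effective A l"
  shows "effective A (\<lambda>x. filter (P x) (l x))"
proof -
  have "effective A (\<lambda>x. concat (map (\<lambda>y. if P x y then [y] else []) (l x)))"
    by (intro effective_intros assms)
  moreover have "concat (map (\<lambda>y. if Q y then [y] else []) xs) = filter Q xs" for Q and xs :: "'b list"
    by (induction xs) simp_all
  ultimately show ?thesis
    by simp
qed

lemma effective_pred_Ball_set [effective_intros]:
  assumes "effective_pred A (\<lambda>z. P (fst z) (snd z))" and "effective A l"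
  shows "effective_pred A (\<lambda>x. \<forall>y \<in> set (l x). P x y)"
proof -
  have "effective_pred A (\<lambda>x. filter (\<lambda>y. \<not> P x y) (l x) = [])"
    by (intro effective_intros assms)
  then show ?thesis
    by (simp add: filter_empty_conv)
qed

lemma effective_pred_in_set [effective_intros]:
  assumes "effective A f" and "effective A l"
  shows "effective_pred A (\<lambda>x. f x \<in> set (l x))"
proof -
  have "effective_pred A (\<lambda>x. \<not> (\<forall>y \<in> set (l x). y \<noteq> f x))"
    using effective_comp[OF assms(1) effective_fst[OF effective_id]]
    by (intro effective_intros assms)
  moreover have "(\<not> (\<forall>y \<in> set (l x). y \<noteq> f x)) = (f x \<in> set (l x))" for x
    by blast
  ultimately show ?thesis
    by simp
qed


section \<open>Automata that stop at the first final state\<close>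

text \<open>\<open>T ! q ! a\<close>, but with a default value outside the table, so that it is computable without
  conditions.\<close>

definition entry :: "nat list list \<Rightarrow> nat \<Rightarrow> nat \<Rightarrow> nat" where
  "entry T q a = hd (drop a (hd (drop q T)))"

lemma effective_entry [effective_intros]:
  assumes "effective A T" and "effective A q" and "effective A a"
  shows "effective A (\<lambda>x. entry (T x) (q x) (a x))"
  unfolding entry_def by (intro effective_intros assms)

definition absorbing_step :: "nat list list \<Rightarrow> nat list \<Rightarrow> nat \<Rightarrow> nat \<Rightarrow> nat" where
  "absorbing_step T F q a = (if q \<in> set F then q else entry T q a)"

definition absorbing_run :: "nat list list \<Rightarrow> nat list \<Rightarrow> nat \<Rightarrow> nat list \<Rightarrow> nat" where
  "absorbing_run T F = foldl (absorbing_step T F)"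

lemma effective_absorbing_run [effective_intros]:
  assumes "effective A T" and "effective A F" and "effective A q" and "effective A u"
  shows "effective A (\<lambda>x. absorbing_run (T x) (F x) (q x) (u x))"
  unfolding absorbing_run_def absorbing_step_def
  \<comment> \<open>Inside the fold \<open>x\<close> is the first component of a triple; the
    composed copies of the assumptions cover \<open>T\<close> and \<open>F\<close> there.\<close>
  by (intro effective_intros assms effective_comp[OF assms(1)] effective_comp[OF assms(2)])

lemma entry_eq_nth:
  assumes "is_dfa k (DFA s T F)" and "q < length T" and "a < k"
  shows "entry T q a = T ! q ! a" and "entry T q a < length T"
proof -
  have "length (T ! q) = k" "set (T ! q) \<subseteq> {..<length T}"
    using assms by (auto simp: is_dfa_def)
  then show "entry T q a = T ! q ! a" "entry T q a < length T"
    using assms by (auto simp: entry_def hd_drop_conv_nth dest: nth_mem)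
qed

lemma absorbing_run_simps [simp]:
  "absorbing_run T F q [] = q"
  "absorbing_run T F q (a # u) = absorbing_run T F (absorbing_step T F q a) u"
  "absorbing_run T F q (u @ v) = absorbing_run T F (absorbing_run T F q u) v"
  by (simp_all add: absorbing_run_def)

lemma absorbing_run_final: "q \<in> set F \<Longrightarrow> absorbing_run T F q u = q"
  by (induction u) (simp_all add: absorbing_step_def)

lemma absorbing_run_less:
  assumes "is_dfa k (DFA s T F)" and "q < length T" and "u \<in> lists {..<k}"
  shows "absorbing_run T F q u < length T"
  using assms(2,3)
  by (induction u arbitrary: q) (auto simp: absorbing_step_def entry_eq_nth(2)[OF assms(1)])

lemma run_less:
  assumes "is_dfa k M" and "q < length (table M)" and "u \<in> lists {..<k}"
  shows "run M q u < length (table M)"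
  using assms(2,3)
proof (induction u arbitrary: q)
  case (Cons a u)
  then have "table M ! q \<in> set (table M)" "a < length (table M ! q)"
    using assms(1) by (auto simp: is_dfa_def)
  then have "table M ! q ! a < length (table M)"
    using assms(1) by (fastforce simp: is_dfa_def dest: nth_mem)
  then show ?case
    using Cons by (simp add: run_def)
qed (simp add: run_def)

text \<open>Reaching a final state is irrevocable for the absorbing run, so its end records whether
  the ordinary run is in a final state after some prefix of \<open>u\<close>. This is what counts,
  since \<open>Pref\<close> is closed under prefixes.\<close>

lemma absorbing_run_iff:
  assumes M: "is_dfa k (DFA s T F)" and "q < length T" and "u \<in> lists {..<k}"
  shows "absorbing_run T F q u \<in> set F \<longleftrightarrow> (\<exists>n. run (DFA s T F) q (take n u) \<in> set F)"
  using assms(2,3)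
proof (induction u arbitrary: q)
  case (Cons a u)
  then have a: "a < k"
    by simp
  show ?case
  proof (cases "q \<in> set F")
    case True
    then show ?thesis
      using absorbing_run_final[OF True] by (auto simp: absorbing_step_def run_def intro: exI[of _ 0])
  next
    case False
    have ex: "(\<exists>n. P n) \<longleftrightarrow> P 0 \<or> (\<exists>n. P (Suc n))" for P
      by (metis not0_implies_Suc)
    show ?thesis
      using Cons a False entry_eq_nth[OF M Cons.prems(1) a]
      by (subst ex) (simp add: absorbing_step_def run_def)
  qed
qed (simp add: run_def)

section \<open>The automaton behind the queries\<close>

text \<open>Over \<open>{0, 1}\<close>, this automaton accepts the words that, followed by \<open>#\<close>, lead the automaton
  \<open>DFA s T F\<close> from \<open>q\<close> through a final state or out of \<open>S\<close>.\<close>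

definition escape_dfa :: "nat list list \<Rightarrow> nat list \<Rightarrow> nat list \<Rightarrow> nat \<Rightarrow> dfa" where
  "escape_dfa T F S q =
     DFA q (map (\<lambda>r. [absorbing_step T F r 0, absorbing_step T F r 1]) [0..<length T])
       (filter (\<lambda>r. r \<in> set F \<or> entry T r hash \<notin> set S) [0..<length T])"

lemma encode_DFA: "encode_dfa (DFA s T F) = enc [s, enc T, enc F]"
proof -
  have "list_encode = (enc :: nat list \<Rightarrow> nat)"
    by (simp add: fun_eq_iff enc_nat_list)
  then show ?thesis
    by (simp add: encode_dfa_def enc_list_def[of T] flip: enc_nat_list)
qed

lemma effective_escape_dfa [effective_intros]:
  assumes "effective A T" and "effective A F" and "effective A S" and "effective A q"
  shows "effective A (\<lambda>x. encode_dfa (escape_dfa (T x) (F x) (S x) (q x)))"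
  unfolding escape_dfa_def encode_DFA absorbing_step_def
  by (intro effective_intros assms effective_comp[OF assms(1)] effective_comp[OF assms(2)]
      effective_comp[OF assms(3)])

lemma run_escape_dfa:
  assumes M: "is_dfa 3 (DFA s T F)" and "r < length T" and "v \<in> lists {..<2}"
  shows "run (escape_dfa T F S q) r v = absorbing_run T F r v"
  using assms(2,3)
proof (induction v arbitrary: r)
  case (Cons a v)
  have "a = 0 \<or> a = 1"
    using Cons.prems by auto
  moreover have "absorbing_step T F r a < length T"
    using Cons.prems entry_eq_nth[OF M] by (simp add: absorbing_step_def)
  ultimately show ?case
    using Cons by (auto simp: run_def escape_dfa_def)
qed (simp add: run_def)

lemma is_dfa_escape_dfa:
  assumes M: "is_dfa 3 (DFA s T F)" and q: "q < length T"
  shows "is_dfa 2 (escape_dfa T F S q)"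
  using assms entry_eq_nth[OF M] by (auto simp: is_dfa_def escape_dfa_def absorbing_step_def)

text \<open>The letter # lies outside the alphabet of the query, so its effect is folded into the
  choice of final states. A visit to \<open>F\<close> inside \<open>v\<close> is not lost, because
  absorption keeps it until the end of \<open>v\<close>.\<close>

lemma escape_dfa_in_RR_iff:
  assumes M: "is_dfa 3 (DFA s T F)" and q: "q < length T" and L: "L \<subseteq> lists {..<2}"
  shows "encode_dfa (escape_dfa T F S q) \<in> RR 2 L \<longleftrightarrow>
    (\<exists>v \<in> L. absorbing_run T F q v \<in> set F \<or> absorbing_run T F q (v @ [hash]) \<notin> set S)"
proof -
  have "v \<in> lang 2 (escape_dfa T F S q) \<longleftrightarrow>
      absorbing_run T F q v \<in> set F \<or> absorbing_run T F q (v @ [hash]) \<notin> set S" if "v \<in> L" for v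
  proof -
    have v: "v \<in> lists {..<2}"
      using L that by blast
    then have "v \<in> lists {..<3}"
      by auto
    then have "absorbing_run T F q v < length T"
      by (rule absorbing_run_less[OF M q])
    moreover have "v \<in> lang 2 (escape_dfa T F S q) \<longleftrightarrow>
        absorbing_run T F q v \<in> set (finals (escape_dfa T F S q))"
      using run_escape_dfa[OF M q v, of S q] v by (simp add: lang_def escape_dfa_def)
    ultimately show ?thesis
      by (auto simp: escape_dfa_def absorbing_step_def)
  qed
  then show ?thesis
    using is_dfa_escape_dfa[OF M q] by (auto simp: encode_dfa_in_RR_iff)
qed


section \<open>Deciding the prefix realizability problem\<close>

definition morph :: "(nat \<Rightarrow> nat list) \<Rightarrow> nat list \<Rightarrow> nat list" where
  "morph w u = concat (map (\<lambda>i. w i @ [hash]) u)"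

lemma morph_simps [simp]:
  "morph w [] = []" "morph w (i # u) = w i @ hash # morph w u" "morph w (u @ v) = morph w u @ morph w v"
  by (simp_all add: morph_def)

lemma length_morph: "length u \<le> length (morph w u)"
  by (induction u) simp_all

lemma morph_in_lists:
  assumes "range w \<subseteq> lists {..<2}"
  shows "morph w u \<in> lists {..<3}"
proof (induction u)
  case (Cons i u)
  have "w i \<in> lists {..<2}"
    using assms by blast
  then have "w i \<in> lists {..<3}"
    by auto
  with Cons show ?case
    by simp
qed simp

lemma morph_stream_prefix:
  "morph_stream (\<lambda>i. w i @ [hash]) U = morph w (stake n U) @- morph_stream (\<lambda>i. w i @ [hash]) (sdrop n U)"
  unfolding morph_def by (rule morph_stream_shift) simp

text \<open>Every block contributes at least its #, so \<open>n\<close> blocks cover the first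
  \<open>n\<close> letters of the image.\<close>

lemma stake_morph_stream:
  "m \<le> n \<Longrightarrow> stake m (morph_stream (\<lambda>i. w i @ [hash]) U) = take m (morph w (stake n U))"
  using length_morph[of "stake n U" w] by (subst morph_stream_prefix[of w U n]) (simp add: stake_shift)

lemma morph_stake_in_Pref: "morph w (stake n U) \<in> Pref (morph_stream (\<lambda>i. w i @ [hash]) U)"
proof -
  have "stake (length (morph w (stake n U))) (morph_stream (\<lambda>i. w i @ [hash]) U) = morph w (stake n U)"
    by (subst morph_stream_prefix[of w U n]) (simp add: stake_shift)
  then show ?thesis
    unfolding Pref_def by (metis (mono_tags, lifting) mem_Collect_eq)
qed

lemma take_in_Pref: "u \<in> Pref W \<Longrightarrow> take n u \<in> Pref W"
  by (auto simp: Pref_def take_stake)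

lemma in_Pref_morph_streamE:
  assumes "u \<in> Pref (morph_stream (\<lambda>i. w i @ [hash]) U)"
  obtains n where "\<And>m. n \<le> m \<Longrightarrow> u = take (length u) (morph w (stake m U))"
proof -
  obtain n where u: "u = stake n (morph_stream (\<lambda>i. w i @ [hash]) U)"
    using assms by (auto simp: Pref_def)
  have "u = take (length u) (morph w (stake m U))" if "n \<le> m" for m
    using stake_morph_stream[OF that, of w U] u by (metis length_stake)
  then show ?thesis
    by (rule that)
qed

text \<open>In the second disjunct the list is a trap without final states.  Entries that are not states are
  harmless, since the run never meets them.\<close>

definition settled :: "nat list set \<Rightarrow> (nat \<Rightarrow> nat list) \<Rightarrow> nat stream \<Rightarrow>
    nat list list \<Rightarrow> nat list \<Rightarrow> nat \<Rightarrow> nat \<times> nat list \<Rightarrow> bool" where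
  "settled L w U T F s c \<longleftrightarrow>
     (let p = absorbing_run T F s (morph w (stake (fst c) U))
      in p \<in> set F \<or> p \<in> set (snd c) \<and>
        (\<forall>q \<in> set (snd c). encode_dfa (escape_dfa T F (snd c) q) \<notin> RR 2 L))"

section \<open>Correctness and termination of the search\<close>

context
  fixes L :: "nat list set" and w :: "nat \<Rightarrow> nat list" and U :: "nat stream"
    and T :: "nat list list" and F :: "nat list" and s :: nat
  assumes L: "L \<subseteq> lists {..<2}" and w: "range w = L" and U: "\<And>u. factor u U"
    and M: "is_dfa 3 (DFA s T F)"
begin

abbreviation state :: "nat \<Rightarrow> nat" where
  "state n \<equiv> absorbing_run T F s (morph w (stake n U))"

lemma start_less: "s < length T"
  using M by (simp add: is_dfa_def)

lemma morph_in_lists': "morph w u \<in> lists {..<3}"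
  using L by (intro morph_in_lists) (simp only: w)

lemma run_morph_less: "q < length T \<Longrightarrow> absorbing_run T F q (morph w u) < length T"
  using morph_in_lists' by (rule absorbing_run_less[OF M, rotated])

lemma state_add: "state (n + m) = absorbing_run T F (state n) (morph w (stake m (sdrop n U)))"
  by (simp only: absorbing_run_simps morph_simps flip: stake_add)

lemma state_final_iff: "state n \<in> set F \<longleftrightarrow> (\<exists>m. run (DFA s T F) s (take m (morph w (stake n U))) \<in> set F)"
  using morph_in_lists' by (rule absorbing_run_iff[OF M start_less])

text \<open>An accepted prefix may end inside a block. Absorption carries its final state to the end
  of any later block, and conversely a final \<open>state n\<close> comes from some prefix of the
  first \<open>n\<close> blocks.\<close>

lemma Pref_meets_lang_iff:
  "Pref (morph_stream (\<lambda>i. w i @ [hash]) U) \<inter> lang 3 (DFA s T F) \<noteq> {} \<longleftrightarrow> (\<exists>n. state n \<in> set F)"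
  (is "?P \<inter> _ \<noteq> {} \<longleftrightarrow> _")
proof
  assume "?P \<inter> lang 3 (DFA s T F) \<noteq> {}"
  then obtain u where u: "u \<in> ?P" "run (DFA s T F) s u \<in> set F"
    by (auto simp: lang_def)
  obtain n where "u = take (length u) (morph w (stake n U))"
    using in_Pref_morph_streamE[OF u(1)] by blast
  then show "\<exists>n. state n \<in> set F"
    unfolding state_final_iff using u(2) by metis
next
  assume "\<exists>n. state n \<in> set F"
  then obtain n m where fin: "run (DFA s T F) s (take m (morph w (stake n U))) \<in> set F"
    unfolding state_final_iff by (elim exE)
  have "set (morph w (stake n U)) \<subseteq> {..<3}"
    using morph_in_lists' by (simp add: lists_eq_set)
  then have "set (take m (morph w (stake n U))) \<subseteq> {..<3}"
    by (rule order_trans[OF set_take_subset])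
  then have "take m (morph w (stake n U)) \<in> lang 3 (DFA s T F)"
    using fin by (simp add: lang_def lists_eq_set)
  then show "?P \<inter> lang 3 (DFA s T F) \<noteq> {}"
    using take_in_Pref[OF morph_stake_in_Pref] by blast
qed

text \<open>Induction over the blocks: a negative query for \<open>q\<close> says that no
  \<open>w i\<close> followed by # leads out of \<open>S\<close> or through a final state, so the
  next block starts in \<open>S\<close> again.\<close>

lemma trap:
  assumes "\<And>q. q \<in> set S \<Longrightarrow> encode_dfa (escape_dfa T F S q) \<notin> RR 2 L"
    and "q \<in> set S" and "q < length T"
  shows "absorbing_run T F q (morph w u) \<in> set S - set F"
  using assms(2,3)
proof (induction u arbitrary: q)
  case Nil
  \<comment> \<open>\<open>w 0\<close> is just some element of \<open>L\<close>: a final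
    \<open>q\<close> would absorb it and make the query positive.\<close>
  have "absorbing_run T F q (w 0) \<notin> set F"
    using escape_dfa_in_RR_iff[OF M _ L, of q S] assms(1) Nil w by blast
  then have "q \<notin> set F"
    using absorbing_run_final by metis
  with Nil show ?case
    by simp
next
  case (Cons i u)
  have "absorbing_run T F q (w i @ [hash]) \<in> set S"
    using escape_dfa_in_RR_iff[OF M _ L, of q S] assms(1) Cons.prems w by blast
  moreover have "absorbing_run T F q (w i @ [hash]) < length T"
    using run_morph_less[OF Cons.prems(2), of "[i]"] by simp
  ultimately have "absorbing_run T F (absorbing_run T F q (w i @ [hash])) (morph w u) \<in> set S - set F"
    by (rule Cons.IH)
  then show ?case
    by simp
qed

text \<open>A final state met before \<open>n\<close> would have been kept up to \<open>n\<close> by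
  absorption; one met after \<open>n\<close> is excluded by the trap.\<close>

lemma settled_sound:
  assumes "settled L w U T F s (n, S)" and "state m \<in> set F"
  shows "state n \<in> set F"
proof (rule ccontr)
  assume n: "state n \<notin> set F"
  have "state n \<in> set S" "\<And>q. q \<in> set S \<Longrightarrow> encode_dfa (escape_dfa T F S q) \<notin> RR 2 L"
    using assms(1) n by (auto simp: settled_def Let_def)
  then have trap: "absorbing_run T F (state n) (morph w u) \<notin> set F" for u
    using trap[of S "state n" u] run_morph_less[OF start_less] by blast
  show False
  proof (cases "m \<le> n")
    case True
    then have "state n = absorbing_run T F (state m) (morph w (stake (n - m) (sdrop m U)))"
      using state_add[of m "n - m"] by simp
    then show False
      using n assms(2) absorbing_run_final by metis
  next
    case False
    then have "state m = absorbing_run T F (state n) (morph w (stake (m - n) (sdrop n U)))"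
      using state_add[of n "m - n"] by simp
    then show False
      using trap assms(2) by metis
  qed
qed

lemma settled_complete: "\<exists>c. settled L w U T F s c"
proof -
  \<comment> \<open>The states from which no sequence of blocks reaches a final state; the case
    \<open>u = []\<close> makes \<open>D\<close> disjoint from \<open>F\<close>. This set will be
    the list \<open>S\<close>.\<close>
  define D where "D = {q. q < length T \<and> (\<forall>u. absorbing_run T F q (morph w u) \<notin> set F)}"
  have D_closed: "absorbing_run T F q (morph w u) \<in> D" if "q \<in> D" for q u
  proof -
    have "absorbing_run T F q (morph w (u @ v)) \<notin> set F" for v
      using that unfolding D_def by blast
    then show ?thesis
      using that run_morph_less by (auto simp: D_def)
  qed
  have stays: "absorbing_run T F q (morph w u) \<in> set F \<union> D" if "q \<in> set F \<union> D" for q u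
    using that D_closed absorbing_run_final by auto
  have "\<exists>u. \<forall>q \<in> Q. absorbing_run T F q (morph w u) \<in> set F \<union> D"
    if "finite Q" "Q \<subseteq> {..<length T}" for Q
    using that
  proof (induction Q)
    case (insert q Q)
    then obtain u where u: "\<forall>q \<in> Q. absorbing_run T F q (morph w u) \<in> set F \<union> D"
      by auto
    \<comment> \<open>The word found so far sends \<open>q\<close> to \<open>r\<close>. A word
      \<open>v\<close> that settles \<open>r\<close> is appended (the empty one if \<open>r\<close>
      is already in \<open>D\<close>), and by \<open>stays\<close> the states treated before remain
      settled.\<close>
    define r where "r = absorbing_run T F q (morph w u)"
    have "r < length T"
      unfolding r_def using insert.prems by (intro run_morph_less) simp
    then obtain v where "absorbing_run T F r (morph w v) \<in> set F \<union> D"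
      using D_closed[of r "[]"] unfolding D_def by blast
    then have "\<forall>q \<in> insert q Q. absorbing_run T F q (morph w (u @ v)) \<in> set F \<union> D"
      using u stays by (simp add: r_def)
    then show ?case
      by blast
  qed simp
  from this[of "{..<length T}"] obtain u
    where u: "\<And>q. q < length T \<Longrightarrow> absorbing_run T F q (morph w u) \<in> set F \<union> D"
    by auto
  obtain i where "stake (length u) (sdrop i U) = u"
    using U unfolding factor_def by blast
  then have reach: "state (i + length u) \<in> set F \<union> D"
    unfolding state_add using u[OF run_morph_less[OF start_less]] by simp
  have "finite D"
    unfolding D_def by simp
  then obtain S where S: "set S = D"
    using finite_list by blast
  have "encode_dfa (escape_dfa T F S q) \<notin> RR 2 L" if "q \<in> D" for q
  proof -
    have q: "q < length T" and no: "absorbing_run T F q (morph w [i]) \<notin> set F" for i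
      using that unfolding D_def by blast+
    \<comment> \<open>A final state reached before the closing # would survive it, contradicting
      \<open>no\<close>.\<close>
    have "absorbing_run T F q (w i) \<notin> set F" for i
      using no[of i] absorbing_run_final[of "absorbing_run T F q (w i)" F T "[hash]"] by auto
    moreover have "absorbing_run T F q (w i @ [hash]) \<in> D" for i
      using D_closed[OF that, of "[i]"] by simp
    ultimately show ?thesis
      using escape_dfa_in_RR_iff[OF M q L, of S] w S by auto
  qed
  then have "settled L w U T F s (i + length u, S)"
    using reach S by (auto simp: settled_def Let_def)
  then show ?thesis ..
qed

text \<open>By \<open>settled_sound\<close> all settled pairs give the same verdict, so the one with
  the least code may be used; it exists because every pair is \<open>dec\<close> of its
  code.\<close>

lemma Least_settled:
  "Pref (morph_stream (\<lambda>i. w i @ [hash]) U) \<inter> lang 3 (DFA s T F) \<noteq> {} \<longleftrightarrow>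
    state (fst (dec (LEAST k. settled L w U T F s (dec k)) :: nat \<times> nat list)) \<in> set F"
proof -
  define c :: "nat \<times> nat list" where "c = dec (LEAST k. settled L w U T F s (dec k))"
  obtain c' where "settled L w U T F s c'"
    using settled_complete by blast
  then have "settled L w U T F s (dec (enc c'))"
    by simp
  then have "settled L w U T F s c"
    unfolding c_def by (rule LeastI)
  then have "(\<exists>m. state m \<in> set F) \<longleftrightarrow> state (fst c) \<in> set F"
    using settled_sound[of "fst c" "snd c"] by auto
  then show ?thesis
    unfolding Pref_meets_lang_iff c_def .
qed

end


section \<open>Codes of automata\<close>

definition dfa_of_code :: "nat \<Rightarrow> dfa" where
  "dfa_of_code x = (let xs = dec x in DFA (hd xs) (dec (hd (tl xs))) (dec (hd (tl (tl xs)))))"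

text \<open>\<open>dfa_of_code\<close> ignores entries after the third, so the length test is what
  separates the code of an automaton from longer lists that decode to the same automaton.\<close>

definition valid_code :: "nat \<Rightarrow> nat \<Rightarrow> bool" where
  "valid_code k x \<longleftrightarrow> length (dec x :: nat list) = 3 \<and> is_dfa k (dfa_of_code x)"

lemma dfa_of_code_encode_dfa [simp]: "dfa_of_code (encode_dfa M) = M"
  by (cases M) (simp add: dfa_of_code_def encode_DFA del: enc_Cons)

lemma encode_dfa_of_code:
  assumes "valid_code k x"
  shows "encode_dfa (dfa_of_code x) = x"
proof -
  obtain a b c :: nat where "dec x = [a, b, c]"
    using assms by (auto simp: valid_code_def numeral_3_eq_3 length_Suc_conv)
  moreover from this have "enc [a, b, c] = x"
    by (metis enc_dec)
  ultimately show ?thesis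
    by (simp add: dfa_of_code_def encode_DFA del: enc_Cons)
qed

lemma valid_code_encode_dfa [simp]: "valid_code k (encode_dfa M) \<longleftrightarrow> is_dfa k M"
proof -
  have "length (dec (encode_dfa M) :: nat list) = 3"
    by (cases M) (simp add: encode_DFA del: enc_Cons)
  then show ?thesis
    by (simp add: valid_code_def)
qed

lemma in_RR_iff: "x \<in> RR k K \<longleftrightarrow> valid_code k x \<and> K \<inter> lang k (dfa_of_code x) \<noteq> {}"
proof
  assume "x \<in> RR k K"
  then show "valid_code k x \<and> K \<inter> lang k (dfa_of_code x) \<noteq> {}"
    by (auto simp: RR_def)
next
  assume x: "valid_code k x \<and> K \<inter> lang k (dfa_of_code x) \<noteq> {}"
  then show "x \<in> RR k K"
    using encode_dfa_in_RR_iff[of "dfa_of_code x" k K] encode_dfa_of_code[of k x]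
    by (simp add: valid_code_def)
qed

lemma effective_dfa_of_code [effective_intros]:
  assumes "effective A f"
  shows "effective A (\<lambda>x. start (dfa_of_code (f x)))"
    and "effective A (\<lambda>x. table (dfa_of_code (f x)))"
    and "effective A (\<lambda>x. finals (dfa_of_code (f x)))"
  unfolding dfa_of_code_def Let_def dfa.sel by (intro effective_intros assms)+

lemma effective_pred_valid_code [effective_intros]:
  assumes "effective A f"
  shows "effective_pred A (\<lambda>x. valid_code k (f x))"
  \<comment> \<open>Inclusions between finite sets become bounded quantifiers over lists, the form
    covered by \<open>effective_pred_Ball_set\<close>.\<close>
  unfolding valid_code_def is_dfa_def subset_eq lessThan_iff
  by (intro effective_intros assms effective_comp[OF assms])

lemma effective_encode_DFA [effective_intros]:
  assumes "effective A s" and "effective A T" and "effective A F"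
  shows "effective A (\<lambda>x. encode_dfa (DFA (s x) (T x) (F x)))"
  unfolding encode_DFA by (intro effective_intros assms)

lemma computable_in_iff_effective:
  fixes f :: "nat \<Rightarrow> nat"
  shows "computable_in A f \<longleftrightarrow> effective A f"
  by (simp add: effective_def)

lemma turing_reducible_iff: "B \<le>\<^sub>T A \<longleftrightarrow> effective_pred A (\<lambda>x. x \<in> B)"
proof -
  have "(if x \<in> B then 1 else 0) = (of_bool (x \<in> B) :: nat)" for x
    by simp
  then show ?thesis
    unfolding turing_reducible_def effective_pred_def computable_in_iff_effective by presburger
qed

section \<open>The Turing reduction\<close>

lemma effective_morph_stake:
  assumes "effective A w" and "effective A (\<lambda>n. U !! n)" and "effective A f"
  shows "effective A (\<lambda>x. morph w (stake (f x) U))"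
proof -
  have "effective A (\<lambda>x. concat (map (\<lambda>i. w (U !! i) @ [hash]) [0..<f x]))"
    by (intro effective_intros assms effective_comp[OF assms(1)] effective_comp[OF assms(2)])
  moreover have "stake n U = map (\<lambda>i. U !! i) [0..<n]" for n
    by (rule nth_equalityI) simp_all
  ultimately show ?thesis
    by (simp add: morph_def comp_def)
qed

lemma Rp_turing_reducible:
  fixes U :: "nat stream"
  assumes L: "L \<subseteq> lists {..<2}" and w: "range w = L" and U: "\<And>u. factor u U"
    and "effective (RR 2 L) w" and "effective (RR 2 L) (\<lambda>n. U !! n)"
  shows "Rp 3 (morph_stream (\<lambda>i. w i @ [hash]) U) \<le>\<^sub>T RR 2 L"
proof -
  let ?A = "RR 2 L" and ?s = "\<lambda>x. start (dfa_of_code x)" and ?T = "\<lambda>x. table (dfa_of_code x)"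
    and ?F = "\<lambda>x. finals (dfa_of_code x)"
  \<comment> \<open>The disjunct for invalid codes makes the search total, as regular minimisation
    demands; such inputs are rejected afterwards.\<close>
  define search where
    "search x = (LEAST k. \<not> valid_code 3 x \<or> settled L w U (?T x) (?F x) (?s x) (dec k))" for x
  define halt :: "nat \<Rightarrow> nat \<times> nat list" where "halt x = dec (search x)" for x
  have ex: "\<exists>k. \<not> valid_code 3 x \<or> settled L w U (?T x) (?F x) (?s x) (dec k)" for x
  proof (cases "valid_code 3 x")
    case True
    then have "is_dfa 3 (DFA (?s x) (?T x) (?F x))"
      by (simp add: valid_code_def)
    from settled_complete[OF L w U this] obtain c where "settled L w U (?T x) (?F x) (?s x) c"
      by blast
    then have "settled L w U (?T x) (?F x) (?s x) (dec (enc c))"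
      by simp
    then show ?thesis
      by blast
  qed simp
  have halt: "effective ?A halt"
    unfolding halt_def search_def settled_def Let_def
    \<comment> \<open>The oracle enters here only, through the queries in
      \<open>settled\<close>.\<close>
    by (intro effective_dec effective_Least ex[unfolded settled_def Let_def] effective_intros
        effective_morph_stake effective_pred_oracle assms)
  have "effective_pred ?A (\<lambda>x. valid_code 3 x \<and>
      absorbing_run (?T x) (?F x) (?s x) (morph w (stake (fst (halt x)) U)) \<in> set (?F x))"
    by (intro effective_intros effective_morph_stake halt assms)
  moreover have "x \<in> Rp 3 (morph_stream (\<lambda>i. w i @ [hash]) U) \<longleftrightarrow> valid_code 3 x \<and>
      absorbing_run (?T x) (?F x) (?s x) (morph w (stake (fst (halt x)) U)) \<in> set (?F x)" for x
  proof (cases "valid_code 3 x")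
    case True
    then have "is_dfa 3 (DFA (?s x) (?T x) (?F x))"
      by (simp add: valid_code_def)
    from Least_settled[OF L w U this] True show ?thesis
      by (simp add: Rp_def in_RR_iff halt_def search_def)
  qed (simp add: Rp_def in_RR_iff)
  ultimately show ?thesis
    unfolding turing_reducible_iff by simp
qed


section \<open>The language transformation\<close>

definition blocks :: "nat list list \<Rightarrow> nat list" where
  "blocks vs = concat (map (\<lambda>v. v @ [hash]) vs)"

lemma blocks_simps [simp]:
  "blocks [] = []" "blocks (v # vs) = v @ hash # blocks vs" "blocks (us @ vs) = blocks us @ blocks vs"
  by (simp_all add: blocks_def)

lemma blocks_in_lists: "vs \<in> lists (lists {..<2}) \<Longrightarrow> blocks vs \<in> lists {..<3}"
proof (induction vs)
  case (Cons v vs)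
  then show ?case
    by (auto simp: in_lists_conv_set)
qed simp

lemma blocks_decomposition:
  assumes "x \<in> lists {..<3}"
  obtains vs t where "x = blocks vs @ t" and "vs \<in> lists (lists {..<2})" and "t \<in> lists {..<2}"
proof -
  from assms have "\<exists>vs \<in> lists (lists {..<2}). \<exists>t \<in> lists {..<2}. x = blocks vs @ t"
  proof (induction x rule: rev_induct)
    case (snoc a x)
    then obtain vs t where vs: "vs \<in> lists (lists {..<2})" "t \<in> lists {..<2}" "x = blocks vs @ t"
      by auto
    have "a = hash \<or> a < 2"
      using snoc.prems by auto
    then show ?case
    proof
      assume "a = hash"
      then show ?thesis
        using vs by (intro bexI[of _ "vs @ [t]"] bexI[of _ "[]"]) simp_all
    next
      assume "a < 2"
      then show ?thesis
        using vs by (intro bexI[of _ vs] bexI[of _ "t @ [a]"]) simp_all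
    qed
  qed (auto intro: bexI[of _ "[]"])
  then show ?thesis
    using that by blast
qed

lemma tilde_eq: "tilde R = {blocks (vs @ [v]) | vs v. vs \<in> lists (lists {..<2}) \<and> v \<in> R}"
proof -
  have "star (conc (lists {..<2}) {[hash]}) = blocks ` lists (lists {..<2})"
  proof (intro equalityI subsetI)
    fix x :: "nat list" assume "x \<in> star (conc (lists {..<2}) {[hash]})"
    then obtain us where us: "x = concat us" "us \<in> lists (conc (lists {..<2}) {[hash]})"
      by (auto simp: star_def)
    from us(2) have "\<exists>vs \<in> lists (lists {..<2}). concat us = blocks vs"
    proof (induction us)
      case (Cons u us)
      then obtain v vs where "v \<in> lists {..<2}" "u = v @ [hash]" "vs \<in> lists (lists {..<2})"
          "concat us = blocks vs"
        by (auto simp: conc_def)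
      then show ?case
        by (intro bexI[of _ "v # vs"]) simp_all
    qed (auto intro: bexI[of _ "[]"])
    with us(1) show "x \<in> blocks ` lists (lists {..<2})"
      by auto
  next
    fix x :: "nat list" assume "x \<in> blocks ` lists (lists {..<2})"
    then obtain vs where "vs \<in> lists (lists {..<2})" "x = concat (map (\<lambda>v. v @ [hash]) vs)"
      by (auto simp: blocks_def)
    moreover from this have "map (\<lambda>v. v @ [hash]) vs \<in> lists (conc (lists {..<2}) {[hash]})"
      by (auto simp: conc_def)
    ultimately show "x \<in> star (conc (lists {..<2}) {[hash]})"
      unfolding star_def by blast
  qed
  then have "tilde R = {x @ v @ [hash] | x v. x \<in> blocks ` lists (lists {..<2}) \<and> v \<in> R}"
    by (auto simp: tilde_def conc_def)
  then show ?thesis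
    by auto
qed

text \<open>The end marker # makes the factorisation unique: the first block is what precedes the
  first #, and cancelling it leaves the same situation with one block less.\<close>

lemma blocks_prefix:
  assumes "blocks ws = blocks vs @ z" and "hash \<notin> \<Union> (set ` set ws)" and "hash \<notin> \<Union> (set ` set vs)"
  shows "vs = take (length vs) ws"
  using assms
proof (induction vs arbitrary: ws)
  case (Cons v vs)
  then obtain v' ws' where ws: "ws = v' # ws'"
    by (cases ws) simp_all
  have eq: "v' @ hash # blocks ws' = v @ hash # (blocks vs @ z)"
    using Cons.prems(1) ws by simp
  have "hash \<notin> set v" "hash \<notin> set v'"
    using Cons.prems ws by auto
  then have "takeWhile (\<lambda>a. a \<noteq> hash) (u @ hash # y) = u" if "u \<in> {v, v'}" for u y
    using that by (subst takeWhile_append2) auto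
  from this[of v' "blocks ws'"] this[of v "blocks vs @ z"] have "v' = v"
    unfolding eq by simp
  with eq have "blocks ws' = blocks vs @ z"
    by simp
  then have "vs = take (length vs) ws'"
    using Cons.prems(2,3) ws by (intro Cons.IH) auto
  then show ?case
    using ws \<open>v' = v\<close> by simp
qed simp

text \<open>A word of \<open>tilde R\<close> ends with #, so as a prefix of the image it ends at a
  block boundary and its last block is some \<open>w i\<close>, a word of both \<open>R\<close> and
  \<open>L\<close>. Conversely, any \<open>w i\<close> in \<open>R\<close> closes such a prefix
  because the letter \<open>i\<close> occurs in \<open>U\<close>.\<close>

lemma tilde_meets_Pref_iff:
  fixes U :: "nat stream"
  assumes L: "L \<subseteq> lists {..<2}" and w: "range w = L" and U: "\<And>u. factor u U"
    and R: "R \<subseteq> lists {..<2}"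
  shows "R \<inter> L \<noteq> {} \<longleftrightarrow> tilde R \<inter> Pref (morph_stream (\<lambda>i. w i @ [hash]) U) \<noteq> {}"
proof -
  have morph_w: "morph w u = blocks (map w u)" for u
    by (simp add: morph_def blocks_def comp_def)
  have "w i \<in> lists {..<2}" for i
    using L rangeI[of w i] unfolding w by (rule subsetD)
  then have map_w: "map w u \<in> lists (lists {..<2})" for u
    by (auto simp: in_lists_conv_set)
  show ?thesis
  proof
    assume "R \<inter> L \<noteq> {}"
    then obtain i where i: "w i \<in> R"
      using w by blast
    \<comment> \<open>The prefix wanted ends with the block of this occurrence of
      \<open>i\<close>.\<close>
    obtain j where "stake 1 (sdrop j U) = [i]"
      using U[of "[i]"] by (auto simp: factor_def)
    then have "stake (j + 1) U = stake j U @ [i]"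
      by (simp only: flip: stake_add)
    then have "morph w (stake (j + 1) U) = blocks (map w (stake j U) @ [w i])"
      by (simp only: morph_w list.map map_append)
    moreover have "blocks (map w (stake j U) @ [w i]) \<in> tilde R"
      unfolding tilde_eq mem_Collect_eq using i map_w by (intro exI conjI) (rule refl)
    ultimately show "tilde R \<inter> Pref (morph_stream (\<lambda>i. w i @ [hash]) U) \<noteq> {}"
      using morph_stake_in_Pref[of w "j + 1" U] by (metis IntI empty_iff)
  next
    assume "tilde R \<inter> Pref (morph_stream (\<lambda>i. w i @ [hash]) U) \<noteq> {}"
    then obtain vs v where vs: "vs \<in> lists (lists {..<2})" "v \<in> R"
        "blocks (vs @ [v]) \<in> Pref (morph_stream (\<lambda>i. w i @ [hash]) U)"
      unfolding tilde_eq by blast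
    from vs(3) obtain n where "blocks (vs @ [v]) =
        take (length (blocks (vs @ [v]))) (morph w (stake n U))"
      by (rule in_Pref_morph_streamE) blast
    then obtain k where "blocks (vs @ [v]) = take k (morph w (stake n U))" ..
    then have "blocks (map w (stake n U)) = blocks (vs @ [v]) @ drop k (morph w (stake n U))"
      by (simp only: append_take_drop_id morph_w)
    then have eq: "vs @ [v] = take (length (vs @ [v])) (map w (stake n U))"
      using map_w[of "stake n U"] vs(1,2) R by (intro blocks_prefix) auto
    have "v \<in> set (take (length (vs @ [v])) (map w (stake n U)))"
      by (subst eq[symmetric]) simp
    then have "v \<in> set (map w (stake n U))"
      by (rule in_set_takeD)
    then obtain i where "v = w i"
      by auto
    then show "R \<inter> L \<noteq> {}"
      using vs(2) w by blast
  qed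
qed

section \<open>An automaton for the transformed language\<close>

text \<open>A copy of the start state serves as the only final state.\<close>

definition tilde_dfa :: "dfa \<Rightarrow> dfa" where
  "tilde_dfa M = DFA (start M)
     (map (\<lambda>q. [entry (table M) q 0, entry (table M) q 1,
         if q \<in> set (finals M) then length (table M) else start M])
       ([0..<length (table M)] @ [start M]))
     [length (table M)]"

lemma is_dfa_tilde_dfa:
  assumes "is_dfa 2 M"
  shows "is_dfa 3 (tilde_dfa M)"
proof -
  have M: "is_dfa 2 (DFA (start M) (table M) (finals M))"
    using assms by simp
  have "start M < length (table M)"
    using assms by (simp add: is_dfa_def)
  then show ?thesis
    using entry_eq_nth(2)[OF M] by (auto simp: is_dfa_def tilde_dfa_def less_Suc_eq)
qed

context
  fixes M :: dfa
  assumes M: "is_dfa 2 M"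
begin

lemma start_less_table: "start M < length (table M)"
  using M by (simp add: is_dfa_def)

lemma run_tilde_dfa:
  assumes "q < length (table M)" and "v \<in> lists {..<2}"
  shows "run (tilde_dfa M) q v = run M q v"
  using assms
proof (induction v arbitrary: q)
  case (Cons a v)
  have M': "is_dfa 2 (DFA (start M) (table M) (finals M))"
    using M by simp
  have "a = 0 \<or> a = 1"
    using Cons.prems by auto
  then have "table (tilde_dfa M) ! q ! a = table M ! q ! a" "table M ! q ! a < length (table M)"
    using Cons.prems entry_eq_nth[OF M' Cons.prems(1)]
    by (auto simp: tilde_dfa_def nth_append)
  then show ?case
    using Cons by (simp add: run_def)
qed (simp add: run_def)

text \<open>The start state and its copy have equal rows, so they cannot be told apart once a letter
  has been read; this is why \<open>v\<close> is nonempty.\<close>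

lemma run_tilde_dfa_copy:
  assumes "v \<in> lists {..<2}" and "e \<in> {start M, length (table M)}" and "v \<noteq> []"
  shows "run (tilde_dfa M) e v = run M (start M) v"
proof -
  have "table (tilde_dfa M) ! e = table (tilde_dfa M) ! start M"
    using assms(2) start_less_table by (auto simp: tilde_dfa_def nth_append)
  then have "run (tilde_dfa M) e v = run (tilde_dfa M) (start M) v"
    using assms(3) by (cases v) (simp_all add: run_def)
  then show ?thesis
    using run_tilde_dfa[OF start_less_table assms(1)] by simp
qed

text \<open>The copy is entered only by #, and only from a final state of \<open>M\<close>; any
  other # restarts \<open>M\<close>.\<close>

lemma run_tilde_dfa_block:
  assumes v: "v \<in> lists {..<2}" and e: "e \<in> {start M, length (table M)}"
  shows "run (tilde_dfa M) e (v @ [hash]) = (if v \<in> lang 2 M then length (table M) else start M)"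
proof -
  define q where "q = run M (start M) v"
  have q: "q < length (table M)"
    unfolding q_def using M start_less_table v by (rule run_less)
  have "table (tilde_dfa M) ! run (tilde_dfa M) e v = table (tilde_dfa M) ! q"
  proof (cases "v = []")
    case True
    then show ?thesis
      using e start_less_table by (auto simp: q_def run_def tilde_dfa_def nth_append)
  next
    case False
    then show ?thesis
      using run_tilde_dfa_copy[OF v e] by (simp add: q_def)
  qed
  then have "run (tilde_dfa M) e (v @ [hash]) = (if q \<in> set (finals M) then length (table M) else start M)"
    using q by (simp add: run_def tilde_dfa_def nth_append)
  then show ?thesis
    using v by (simp add: lang_def q_def)
qed

text \<open>Every # leads to the start state or its copy, which behave alike, so only the last block
  matters.\<close>

lemma run_tilde_dfa_blocks:
  assumes "vs \<in> lists (lists {..<2})"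
  shows "run (tilde_dfa M) (start M) (blocks vs) =
    (if vs \<noteq> [] \<and> last vs \<in> lang 2 M then length (table M) else start M)"
  using assms
proof (induction vs rule: rev_induct)
  case (snoc v vs)
  have "run (tilde_dfa M) (start M) (blocks (vs @ [v])) =
      run (tilde_dfa M) (run (tilde_dfa M) (start M) (blocks vs)) (v @ [hash])"
    by (simp add: run_def)
  also have "\<dots> = (if v \<in> lang 2 M then length (table M) else start M)"
    using snoc by (intro run_tilde_dfa_block) auto
  finally show ?case
    by simp
qed (simp add: run_def)

lemma lang_tilde_dfa: "lang 3 (tilde_dfa M) = tilde (lang 2 M)"
proof (intro equalityI subsetI)
  fix x assume x: "x \<in> lang 3 (tilde_dfa M)"
  then have "x \<in> lists {..<3}" and acc: "run (tilde_dfa M) (start M) x = length (table M)"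
    by (auto simp: lang_def tilde_dfa_def)
  then obtain vs t where vs: "x = blocks vs @ t" "vs \<in> lists (lists {..<2})" "t \<in> lists {..<2}"
    using blocks_decomposition by blast
  define e where "e = run (tilde_dfa M) (start M) (blocks vs)"
  have e: "e \<in> {start M, length (table M)}"
    unfolding e_def using run_tilde_dfa_blocks[OF vs(2)] by simp
  have acc': "run (tilde_dfa M) e t = length (table M)"
    using acc vs(1) by (simp add: e_def run_def)
  \<comment> \<open>A nonempty rest over 0 and 1 would end in a state of \<open>M\<close>, never in
    the copy.\<close>
  have "t = []"
  proof (rule ccontr)
    assume "t \<noteq> []"
    then have "run (tilde_dfa M) e t < length (table M)"
      using run_tilde_dfa_copy[OF vs(3) e] run_less[OF M start_less_table vs(3)] by simp
    then show False
      using acc' by simp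
  qed
  then have "vs \<noteq> []" "last vs \<in> lang 2 M"
    using acc' run_tilde_dfa_blocks[OF vs(2)] start_less_table
    by (auto simp: e_def run_def split: if_splits)
  moreover from \<open>t = []\<close> \<open>vs \<noteq> []\<close> have "x = blocks (butlast vs @ [last vs])"
    using vs(1) by simp
  moreover have "butlast vs \<in> lists (lists {..<2})"
    using vs(2) by (auto dest: in_set_butlastD)
  ultimately show "x \<in> tilde (lang 2 M)"
    unfolding tilde_eq by blast
next
  fix x assume "x \<in> tilde (lang 2 M)"
  then obtain vs v where vs: "vs \<in> lists (lists {..<2})" "v \<in> lang 2 M" "x = blocks (vs @ [v])"
    unfolding tilde_eq by blast
  then have vv: "vs @ [v] \<in> lists (lists {..<2})"
    by (simp add: lang_def)
  have "x \<in> lists {..<3}"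
    unfolding vs(3) using vv by (rule blocks_in_lists)
  then show "x \<in> lang 3 (tilde_dfa M)"
    using run_tilde_dfa_blocks[OF vv] vs by (simp add: lang_def tilde_dfa_def[of M])
qed

end

section \<open>The many-one reduction\<close>

definition tilde_code :: "nat \<Rightarrow> nat" where
  "tilde_code x = (if valid_code 2 x then encode_dfa (tilde_dfa (dfa_of_code x)) else 0)"

lemma computable_tilde_code: "computable tilde_code"
  unfolding computable_def computable_in_iff_effective tilde_code_def tilde_dfa_def
  by (intro effective_intros)

text \<open>0 codes the empty list, hence no automaton; \<open>tilde_code\<close> sends all invalid
  inputs to this negative instance.\<close>

lemma zero_not_in_RR: "0 \<notin> RR k K"
  by (auto simp: RR_def encode_dfa_def)

lemma many_one_reduction_tilde_code:
  fixes U :: "nat stream"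
  assumes "L \<subseteq> lists {..<2}" and "range w = L" and "\<And>u. factor u U"
  shows "many_one_reduction tilde_code (RR 2 L) (Rp 3 (morph_stream (\<lambda>i. w i @ [hash]) U))"
proof -
  have "x \<in> RR 2 L \<longleftrightarrow> tilde_code x \<in> Rp 3 (morph_stream (\<lambda>i. w i @ [hash]) U)" for x
  proof (cases "valid_code 2 x")
    case True
    then have M: "is_dfa 2 (dfa_of_code x)"
      by (simp add: valid_code_def)
    have "lang 2 (dfa_of_code x) \<subseteq> lists {..<2}"
      by (auto simp: lang_def)
    from tilde_meets_Pref_iff[OF assms this] show ?thesis
      using True is_dfa_tilde_dfa[OF M] lang_tilde_dfa[OF M]
      by (simp add: in_RR_iff[of x] tilde_code_def Rp_def encode_dfa_in_RR_iff Int_commute)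
  next
    case False
    then show ?thesis
      using zero_not_in_RR by (simp add: in_RR_iff[of x] tilde_code_def Rp_def)
  qed
  then show ?thesis
    unfolding many_one_reduction_def using computable_tilde_code by blast
qed

theorem mainTheorem6:
  fixes L :: "nat list set" and w :: "nat \<Rightarrow> nat list"
    and W_inf :: "nat stream" and W :: "nat stream"
  assumes "L \<subseteq> lists {..<2}" and "L \<noteq> {}"
    and "decidable (RR 2 L)"
    and "range w = L" and "computable (\<lambda>i. list_encode (w i))"
    and "computable (\<lambda>n. W_inf !! n)"
    and "\<forall>u. factor u W_inf"
    and "W = morph_stream (\<lambda>i. w i @ [hash]) W_inf"
  shows "Rp 3 W \<le>\<^sub>T RR 2 L \<and> RR 2 L \<le>\<^sub>m Rp 3 W \<and>
    decidable (Rp 3 W) \<and>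
    (\<exists>f. many_one_reduction f (RR 2 L) (Rp 3 W) \<and>
         (\<forall>M. is_dfa 2 M \<longrightarrow>
            (\<exists>N. is_dfa 3 N \<and> f (encode_dfa M) = encode_dfa N \<and> lang 3 N = tilde (lang 2 M)))) \<and>
    (\<forall>R. regular 2 R \<longrightarrow> (R \<inter> L \<noteq> {} \<longleftrightarrow> tilde R \<inter> Pref W \<noteq> {}))"
proof (intro conjI)
  have factor: "\<And>u. factor u W_inf"
    using assms(7) by blast
  have w: "effective (RR 2 L) w"
    using computable_imp_computable_in[OF assms(5)] by (simp add: effective_def enc_nat_list)
  have U: "effective (RR 2 L) (\<lambda>n. W_inf !! n)"
    using computable_imp_computable_in[OF assms(6)] by (simp add: computable_in_iff_effective)
  show T: "Rp 3 W \<le>\<^sub>T RR 2 L"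
    unfolding assms(8) using assms(1,4) factor w U by (rule Rp_turing_reducible)
  \<comment> \<open>The decision procedure for \<open>RR 2 L\<close> takes the place of the oracle
    in the Turing reduction.\<close>
  show "decidable (Rp 3 W)"
    unfolding decidable_def computable_def
    by (rule computable_in_trans[OF T[unfolded turing_reducible_def]
        assms(3)[unfolded decidable_def computable_def]])
  have m: "many_one_reduction tilde_code (RR 2 L) (Rp 3 W)"
    unfolding assms(8) using assms(1,4) factor by (rule many_one_reduction_tilde_code)
  then show "RR 2 L \<le>\<^sub>m Rp 3 W"
    unfolding many_one_reducible_def by blast
  have "\<exists>N. is_dfa 3 N \<and> tilde_code (encode_dfa M) = encode_dfa N \<and> lang 3 N = tilde (lang 2 M)"
    if "is_dfa 2 M" for M
    using that is_dfa_tilde_dfa[OF that] lang_tilde_dfa[OF that]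
    by (intro exI[of _ "tilde_dfa M"]) (simp add: tilde_code_def)
  with m show "\<exists>f. many_one_reduction f (RR 2 L) (Rp 3 W) \<and>
      (\<forall>M. is_dfa 2 M \<longrightarrow>
        (\<exists>N. is_dfa 3 N \<and> f (encode_dfa M) = encode_dfa N \<and> lang 3 N = tilde (lang 2 M)))"
    by blast
  show "\<forall>R. regular 2 R \<longrightarrow> (R \<inter> L \<noteq> {} \<longleftrightarrow> tilde R \<inter> Pref W \<noteq> {})"
  proof (intro allI impI)
    fix R assume "regular 2 R"
    then have "R \<subseteq> lists {..<2}"
      by (auto simp: regular_def lang_def)
    then show "R \<inter> L \<noteq> {} \<longleftrightarrow> tilde R \<inter> Pref W \<noteq> {}"
      unfolding assms(8) by (rule tilde_meets_Pref_iff[OF assms(1,4) factor])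
  qed
qed

end
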